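(* If $\mathbf B=\mathbf 0$, then the special relativistic magnetohydrodynamic (RMHD) equations $\partial_t\mathbf U+\sum_{i=1}^d\partial_{x_i}\mathbf F_i(\mathbf U)=\mathbf 0$ satisfy the Lax–Friedrichs (LxF) splitting property: $$\mathbf U\pm\alpha^{-1}\mathbf F_i(\mathbf U)\in\mathcal G\quad\text{for }\mathbf U\in\mathcal G,$$ where $\alpha\ge\varrho_i$ and $\varrho_i$ denotes a proper upper bound of the spectral radius of the Jacobian matrix $\partial\mathbf F_i/\partial\mathbf U$, $i=1,2,3$. If $\mathbf B\neq\mathbf 0$, then the LxF splitting property does not always hold.
   Context: The speed of light is $c=1$ and the equation of state is the $\Gamma$-law $p=(\Gamma-1)\rho e$ with adiabatic index $\Gamma\in(1,2]$. The primitive variables are $\mathbf V=(\rho,\mathbf v,\mathbf B,p)^\top$, where $\rho$ is the rest-mass density, $\mathbf v=(v_1,v_2,v_3)$ the fluid velocity, $\mathbf B=(B_1,B_2,B_3)$ the magnetic field and $p$ the gas pressure. Put $v=|\mathbf v|$, $W=(1-v^2)^{-1/2}$, $h=1+e+\frac p\rho$ with $e$ the specific internal energy, $p_m=\frac12\big(W^{-2}|\mathbf B|^2+(\mathbf v\cdot\mathbf B)^2\big)$ and $p_{tot}=p+p_m$. The conservative vector is $\mathbf U=(D,\mathbf m,\mathbf B,E)^\top\in\mathbb R^8$ with $$D=\rho W,\qquad \mathbf m=\rho hW^2\mathbf v+|\mathbf B|^2\mathbf v-(\mathbf v\cdot\mathbf B)\mathbf B,\qquad E=\rho hW^2-p_{tot}+|\mathbf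 B|^2,$$ and the flux in the $x_i$-direction is $$\mathbf F_i(\mathbf U)=\Big(Dv_i,\ v_i\mathbf m-B_i\big(W^{-2}\mathbf B+(\mathbf v\cdot\mathbf B)\mathbf v\big)+p_{tot}\mathbf e_i,\ v_i\mathbf B-B_i\mathbf v,\ m_i\Big)^\top,$$ with $\mathbf e_i$ the $i$-th row of the $3\times3$ identity matrix. The primitive quantities are regarded as functions of $\mathbf U$ (not explicitly expressible). The admissible state set is $$\mathcal G=\{\mathbf U=(D,\mathbf m,\mathbf B,E)^\top\in\mathbb R^8:\ \rho(\mathbf U)>0,\ p(\mathbf U)>0,\ v(\mathbf U)<c=1\}.$$ The speed of light $c=1$ is a rigorous upper bound of the spectral radius of $\partial\mathbf F_i/\partial\mathbf U$. *)

theory Defs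
  imports "HOL-Analysis.Analysis" "Jordan_Normal_Form.Spectral_Radius"
begin

no_notation Matrix.vec_index (infixl \<open>$\<close> 100)
no_notation Matrix.scalar_prod (infix \<open>\<bullet>\<close> 70)
unbundle inner_syntax

text \<open>Primitive variables are tuples \<open>(\<rho>, v, B, p)\<close>. Conservative vectors and fluxes live in
  \<open>real ^ 8\<close> with component order \<open>D, m1, m2, m3, B1, B2, B3, E\<close>, numbered 1 to 8.\<close>

type_synonym prim_state = "real \<times> (real ^ 3) \<times> (real ^ 3) \<times> real"

definition lorentz :: "real ^ 3 \<Rightarrow> real" where
  "lorentz v = 1 / sqrt (1 - (norm v)\<^sup>2)"

definition internal_energy :: "real \<Rightarrow> real \<Rightarrow> real \<Rightarrow> real" where
  "internal_energy \<Gamma> \<rho> p = p / ((\<Gamma> - 1) * \<rho>)"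

definition enthalpy :: "real \<Rightarrow> real \<Rightarrow> real \<Rightarrow> real" where
  "enthalpy \<Gamma> \<rho> p = 1 + internal_energy \<Gamma> \<rho> p + p / \<rho>"

definition magnetic_pressure :: "real ^ 3 \<Rightarrow> real ^ 3 \<Rightarrow> real" where
  "magnetic_pressure v B = 1/2 * ((norm B)\<^sup>2 / (lorentz v)\<^sup>2 + (v \<bullet> B)\<^sup>2)"

definition mass_density :: "prim_state \<Rightarrow> real" where
  "mass_density = (\<lambda>(\<rho>, v, B, p). \<rho> * lorentz v)"

definition momentum :: "real \<Rightarrow> prim_state \<Rightarrow> real ^ 3" where
  "momentum \<Gamma> = (\<lambda>(\<rho>, v, B, p).
     (\<rho> * enthalpy \<Gamma> \<rho> p * (lorentz v)\<^sup>2) *\<^sub>R v + (norm B)\<^sup>2 *\<^sub>R v - (v \<bullet> B) *\<^sub>R B)"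

definition energy :: "real \<Rightarrow> prim_state \<Rightarrow> real" where
  "energy \<Gamma> = (\<lambda>(\<rho>, v, B, p).
     \<rho> * enthalpy \<Gamma> \<rho> p * (lorentz v)\<^sup>2 - (p + magnetic_pressure v B) + (norm B)\<^sup>2)"

definition state_vec :: "real \<Rightarrow> real ^ 3 \<Rightarrow> real ^ 3 \<Rightarrow> real \<Rightarrow> real ^ 8" where
  "state_vec D m B E = vector [D, m $ 1, m $ 2, m $ 3, B $ 1, B $ 2, B $ 3, E]"

definition cons_of_prim :: "real \<Rightarrow> prim_state \<Rightarrow> real ^ 8" where
  "cons_of_prim \<Gamma> = (\<lambda>(\<rho>, v, B, p).
     state_vec (mass_density (\<rho>, v, B, p)) (momentum \<Gamma> (\<rho>, v, B, p)) B (energy \<Gamma> (\<rho>, v, B, p)))"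

definition flux_of_prim :: "real \<Rightarrow> 3 \<Rightarrow> prim_state \<Rightarrow> real ^ 8" where
  "flux_of_prim \<Gamma> i = (\<lambda>(\<rho>, v, B, p).
     let D = mass_density (\<rho>, v, B, p); m = momentum \<Gamma> (\<rho>, v, B, p)
     in state_vec
       (D * v $ i)
       (v $ i *\<^sub>R m - B $ i *\<^sub>R ((1 / (lorentz v)\<^sup>2) *\<^sub>R B + (v \<bullet> B) *\<^sub>R v)
          + (p + magnetic_pressure v B) *\<^sub>R axis i 1)
       (v $ i *\<^sub>R B - B $ i *\<^sub>R v)
       (m $ i))"

definition admissible_prims :: "prim_state set" where
  "admissible_prims = {(\<rho>, v, B, p). 0 < \<rho> \<and> 0 < p \<and> norm v < 1}"

text \<open>A vector is admissible iff it is the conservative vector of a physical primitive state; the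
  primitive quantities as functions of \<open>U\<close> are given by the inverse of \<open>cons_of_prim\<close> on such
  states, and are meaningful only on \<open>admissible_set\<close>.\<close>

definition admissible_set :: "real \<Rightarrow> (real ^ 8) set" where
  "admissible_set \<Gamma> = cons_of_prim \<Gamma> ` admissible_prims"

definition prim_of_cons :: "real \<Rightarrow> real ^ 8 \<Rightarrow> prim_state" where
  "prim_of_cons \<Gamma> = inv_into admissible_prims (cons_of_prim \<Gamma>)"

definition flux :: "real \<Rightarrow> 3 \<Rightarrow> real ^ 8 \<Rightarrow> real ^ 8" where
  "flux \<Gamma> i U = flux_of_prim \<Gamma> i (prim_of_cons \<Gamma> U)"

definition magnetic_field :: "real ^ 8 \<Rightarrow> real ^ 3" where
  "magnetic_field U = vector [U $ 5, U $ 6, U $ 7]"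

text \<open>The Jacobian is converted to a complex matrix because the eigenvalues entering the spectral
  radius are complex. Rows and columns of the converted matrix are numbered from 0, which accounts
  for the shift; in the index type \<open>8\<close> one has \<open>8 = 0\<close>, so all indices occur.\<close>

definition flux_jacobian :: "real \<Rightarrow> 3 \<Rightarrow> real ^ 8 \<Rightarrow> complex Matrix.mat" where
  "flux_jacobian \<Gamma> i U = Matrix.mat 8 8
     (\<lambda>(r, c). complex_of_real (jacobian (flux \<Gamma> i) (at U) $ of_nat (Suc r) $ of_nat (Suc c)))"

definition LxF_splitting_at :: "real \<Rightarrow> 3 \<Rightarrow> real \<Rightarrow> real ^ 8 \<Rightarrow> bool" where
  "LxF_splitting_at \<Gamma> i \<sigma> U \<longleftrightarrow> (\<forall>\<alpha>\<ge>\<sigma>.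
     U + (1 / \<alpha>) *\<^sub>R flux \<Gamma> i U \<in> admissible_set \<Gamma> \<and>
     U - (1 / \<alpha>) *\<^sub>R flux \<Gamma> i U \<in> admissible_set \<Gamma>)"

end

theory Submission
  imports Defs
begin

text \<open>
  Put \<open>Q = \<rho> h W\<^sup>2\<close>. All primitive variables are explicit functions of \<open>(D, m, B)\<close> and \<open>Q\<close>, and the
  resulting energy is strictly increasing in \<open>Q\<close> as long as the speed stays below that of light
  (\<open>energy_of_enthalpy_strict_mono\<close>). Thus the primitive state of an admissible vector is unique. By the
  inverse function theorem the flux is then differentiable as a function of \<open>U\<close> wherever the derivative
  of the conservative map is injective, and its derivative sends the conservative variation caused by a
  variation of the primitive variables to the corresponding variation of the flux
  (\<open>flux_has_derivative\<close>). This gives access to the spectrum of a Jacobian that has no closed form.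

  If \<open>B = 0\<close>, the two acoustic speeds, that is, the roots \<open>l1 < v $ i < l2\<close> of a quadratic polynomial, are
  eigenvalues, with explicit eigenvectors (\<open>acoustic_speed_le_spectral_radius\<close>). A bound \<open>\<sigma>\<close> on the spectral radius
  thus forces the polynomial to be nonnegative at \<open>\<alpha>\<close> and \<open>- \<alpha>\<close> for \<open>\<alpha> \<ge> \<sigma>\<close>. A vector with
  \<open>B = 0\<close> is admissible as soon as \<open>D > 0\<close>, \<open>E > 0\<close> and \<open>D\<^sup>2 + m \<bullet> m < E\<^sup>2\<close>
  (\<open>state_vec_in_admissible_set\<close>), and for \<open>U \<plusminus> (1 / \<alpha>) F\<close> the last inequality turns out to be weaker
  than the sign condition on the polynomial, because \<open>\<Gamma> \<le> 2\<close> (\<open>energy_gap\<close>).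

  For the failure with \<open>B \<noteq> 0\<close>, take a fluid at rest in a strong magnetic field along the direction of the
  flux. Its Jacobian is sparse enough for all eigenvalues to be found, and they are at most \<open>1\<close> in
  modulus. But the flux contains the magnetic stress, which makes the momentum of \<open>U + F\<close> along the field
  larger in modulus than the energy that remains when the magnetic part is removed, and no fluid moving along
  the field slower than light can have such a momentum (\<open>parallel_field_not_LxF\<close>).
\<close>

section \<open>State vectors as tuples, and eigenvalues of the Jacobian\<close>

lemma exhaust_8:
  fixes x :: 8
  shows "x = 1 \<or> x = 2 \<or> x = 3 \<or> x = 4 \<or> x = 5 \<or> x = 6 \<or> x = 7 \<or> x = 8"
proof (induct x)
  case (of_int z)
  then have "z = 0 \<or> z = 1 \<or> z = 2 \<or> z = 3 \<or> z = 4 \<or> z = 5 \<or> z = 6 \<or> z = 7" by fastforce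
  then show ?case by auto
qed

lemma forall_8: "(\<forall>k::8. P k) \<longleftrightarrow> P 1 \<and> P 2 \<and> P 3 \<and> P 4 \<and> P 5 \<and> P 6 \<and> P 7 \<and> P 8"
  by (metis exhaust_8)

lemma UNIV_8: "(UNIV :: 8 set) = {1, 2, 3, 4, 5, 6, 7, 8}"
  using exhaust_8 by auto

lemma state_vec_nth [simp]:
  "state_vec D m B E $ 1 = D" "state_vec D m B E $ 2 = m $ 1" "state_vec D m B E $ 3 = m $ 2"
  "state_vec D m B E $ 4 = m $ 3" "state_vec D m B E $ 5 = B $ 1" "state_vec D m B E $ 6 = B $ 2"
  "state_vec D m B E $ 7 = B $ 3" "state_vec D m B E $ 8 = E"
  by (simp_all add: state_vec_def vector_def)

definition momentum_field :: "real ^ 8 \<Rightarrow> real ^ 3" where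
  "momentum_field U = vector [U $ 2, U $ 3, U $ 4]"

text \<open>
  Conservative vectors are handled as tuples \<open>(D, m, B, E)\<close>. This type coincides with that of the
  primitive states, so that passing from primitive to conservative variables becomes a map from
  a Euclidean space to itself and the inverse function theorem applies.
\<close>

definition of_blocks :: "real \<times> (real ^ 3) \<times> (real ^ 3) \<times> real \<Rightarrow> real ^ 8" where
  "of_blocks = (\<lambda>(D, m, B, E). state_vec D m B E)"

definition blocks :: "real ^ 8 \<Rightarrow> real \<times> (real ^ 3) \<times> (real ^ 3) \<times> real" where
  "blocks U = (U $ 1, momentum_field U, magnetic_field U, U $ 8)"

lemma field_of_state_vec [simp]:
  "momentum_field (state_vec D m B E) = m" "magnetic_field (state_vec D m B E) = B"
  by (simp_all add: momentum_field_def magnetic_field_def Finite_Cartesian_Product.vec_eq_iff forall_3)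

lemma blocks_of_blocks [simp]: "blocks (of_blocks X) = X"
  by (cases X) (simp add: blocks_def of_blocks_def)

lemma of_blocks_blocks [simp]: "of_blocks (blocks U) = U"
  by (simp add: blocks_def of_blocks_def momentum_field_def magnetic_field_def Finite_Cartesian_Product.vec_eq_iff forall_8)

lemma linear_of_blocks: "linear of_blocks"
  by (rule linearI) (auto simp: of_blocks_def Finite_Cartesian_Product.vec_eq_iff forall_8)

lemma linear_blocks: "linear blocks"
  by (rule linearI)
    (auto simp: blocks_def momentum_field_def magnetic_field_def Finite_Cartesian_Product.vec_eq_iff forall_3)

lemma of_blocks_eq_iff: "of_blocks X = of_blocks Y \<longleftrightarrow> X = Y"
  by (metis blocks_of_blocks)

text \<open>
  Matches the row numbers 0 to 7 of the complex Jacobian with the components of \<open>real ^ 8\<close>.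
\<close>

lemma bij_of_nat_Suc_8: "bij_betw (\<lambda>k. of_nat (Suc k) :: 8) {0..<8} UNIV"
proof -
  have e: "{0..<8::nat} = {0,1,2,3,4,5,6,7}" by auto
  have s: "(\<lambda>k. of_nat (Suc k) :: 8) ` {0..<8} = UNIV"
    unfolding e UNIV_8 by auto
  moreover have "inj_on (\<lambda>k. of_nat (Suc k) :: 8) {0..<8}"
    by (rule eq_card_imp_inj_on) (simp_all add: s del: of_nat_Suc)
  ultimately show ?thesis by (simp add: bij_betw_def)
qed

lemma of_nat_Suc_8_cases:
  fixes r :: 8
  obtains k where "k < 8" "r = of_nat (Suc k)"
proof -
  have "r \<in> (\<lambda>k. of_nat (Suc k)) ` {0..<8}"
    using bij_of_nat_Suc_8 by (simp add: bij_betw_def del: of_nat_Suc)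
  then show ?thesis using that by (auto simp del: of_nat_Suc)
qed

definition complex_vec :: "real ^ 8 \<Rightarrow> real ^ 8 \<Rightarrow> complex Matrix.vec" where
  "complex_vec x y = Matrix.vec 8 (\<lambda>k. Complex (x $ of_nat (Suc k)) (y $ of_nat (Suc k)))"

lemma complex_vec_eq_iff:
  "complex_vec x y = complex_vec x' y' \<longleftrightarrow> x = x' \<and> y = y'"
proof
  assume eq: "complex_vec x y = complex_vec x' y'"
  have "x $ r = x' $ r \<and> y $ r = y' $ r" for r
  proof -
    obtain k where k: "k < 8" "r = of_nat (Suc k)"
      by (rule of_nat_Suc_8_cases)
    from eq have "vec_index (complex_vec x y) k = vec_index (complex_vec x' y') k" by simp
    then show ?thesis using k by (simp add: complex_vec_def)
  qed
  then show "x = x' \<and> y = y'" by (simp add: Finite_Cartesian_Product.vec_eq_iff)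
qed simp

lemma ex_complex_vec:
  assumes "w \<in> carrier_vec 8"
  obtains x y where "w = complex_vec x y"
proof -
  define g where "g = the_inv_into {0..<8} (\<lambda>k. of_nat (Suc k) :: 8)"
  have g: "g (of_nat (Suc k)) = k" if "k < 8" for k
    unfolding g_def using that bij_of_nat_Suc_8 by (intro the_inv_into_f_f) (auto simp: bij_betw_def)
  have "w = complex_vec (\<chi> r. Re (vec_index w (g r))) (\<chi> r. Im (vec_index w (g r)))"
    using assms g by (intro eq_vecI) (auto simp: complex_vec_def simp del: of_nat_Suc)
  then show ?thesis by (rule that)
qed

text \<open>
  A derivative of the flux is unique and is represented by its Jacobian, so the complexified matrix acts
  on real and imaginary parts separately, through that derivative.
\<close>

lemma flux_jacobian_mult:
  assumes der: "(flux \<Gamma> i has_derivative L) (at U)"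
  shows "flux_jacobian \<Gamma> i U *\<^sub>v complex_vec x y = complex_vec (L x) (L y)"
proof (rule eq_vecI)
  let ?J = "jacobian (flux \<Gamma> i) (at U)"
  have "flux \<Gamma> i differentiable (at U)" using der by (auto simp: differentiable_def)
  then have "(flux \<Gamma> i has_derivative (\<lambda>h. ?J *v h)) (at U)" by (simp add: jacobian_works)
  with der have L: "L = (\<lambda>h. ?J *v h)" by (rule has_derivative_unique)
  fix r assume "r < dim_vec (complex_vec (L x) (L y))"
  then have r: "r < 8" by (simp add: complex_vec_def)
  have "vec_index (flux_jacobian \<Gamma> i U *\<^sub>v complex_vec x y) r =
      (\<Sum>k\<in>{0..<8}. complex_of_real (?J $ of_nat (Suc r) $ of_nat (Suc k)) *
         Complex (x $ of_nat (Suc k)) (y $ of_nat (Suc k)))"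
    using r by (simp add: flux_jacobian_def complex_vec_def Matrix.scalar_prod_def del: of_nat_Suc)
  also have "\<dots> = (\<Sum>c\<in>UNIV. complex_of_real (?J $ of_nat (Suc r) $ c) * Complex (x $ c) (y $ c))"
    by (rule sum.reindex_bij_betw[OF bij_of_nat_Suc_8])
  also have "\<dots> = Complex (L x $ of_nat (Suc r)) (L y $ of_nat (Suc r))"
    unfolding L matrix_vector_mult_def by (simp add: complex_eq_iff)
  finally show "vec_index (flux_jacobian \<Gamma> i U *\<^sub>v complex_vec x y) r = vec_index (complex_vec (L x) (L y)) r"
    using r by (simp add: complex_vec_def)
qed (simp add: flux_jacobian_def complex_vec_def)

lemma flux_jacobian_carrier: "flux_jacobian \<Gamma> i U \<in> carrier_mat 8 8"
  by (simp add: flux_jacobian_def)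

lemma zero_complex_vec: "complex_vec 0 0 = 0\<^sub>v 8"
  by (intro eq_vecI) (auto simp: complex_vec_def zero_complex.code)

text \<open>
  Real eigenvectors of the derivative bound the spectral radius from below without any need to know the
  rest of the spectrum.
\<close>

lemma abs_real_eigenvalue_le_spectral_radius:
  assumes der: "(flux \<Gamma> i has_derivative L) (at U)" and x: "x \<noteq> 0" "L x = \<mu> *\<^sub>R x"
  shows "\<bar>\<mu>\<bar> \<le> spectral_radius (flux_jacobian \<Gamma> i U)"
proof -
  have L0: "L 0 = 0" by (rule linear_0[OF has_derivative_linear[OF der]])
  have "flux_jacobian \<Gamma> i U *\<^sub>v complex_vec x 0 = complex_of_real \<mu> \<cdot>\<^sub>v complex_vec x 0"
    unfolding flux_jacobian_mult[OF der] x L0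
    by (intro eq_vecI) (auto simp: complex_vec_def complex_eq_iff)
  moreover have "complex_vec x 0 \<noteq> 0\<^sub>v 8"
    using x unfolding zero_complex_vec[symmetric] complex_vec_eq_iff by simp
  ultimately have "eigenvector (flux_jacobian \<Gamma> i U) (complex_vec x 0) (complex_of_real \<mu>)"
    by (auto simp: eigenvector_def flux_jacobian_def complex_vec_def)
  then have "complex_of_real \<mu> \<in> spectrum (flux_jacobian \<Gamma> i U)"
    by (auto simp: spectrum_def eigenvalue_def)
  then show ?thesis
    using spectral_radius_mem_max(2)[OF flux_jacobian_carrier, of "\<bar>\<mu>\<bar>"]
    by (metis imageI norm_of_real zero_less_numeral)
qed

text \<open>
  The converse tool: a complex eigenvector \<open>x + i y\<close> satisfies the eigenvalue equation in each
  component, so a bound on every such \<open>\<mu>\<close> bounds the spectral radius.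
\<close>

lemma spectral_radius_le_by_eigenvalues:
  assumes der: "(flux \<Gamma> i has_derivative L) (at U)"
    and bound: "\<And>\<mu> x y. (x, y) \<noteq> (0, 0) \<Longrightarrow>
      (\<And>r. Complex (L x $ r) (L y $ r) = \<mu> * Complex (x $ r) (y $ r)) \<Longrightarrow> cmod \<mu> \<le> c"
  shows "spectral_radius (flux_jacobian \<Gamma> i U) \<le> c"
proof -
  from spectral_radius_mem_max(1)[OF flux_jacobian_carrier]
  obtain \<mu> where \<mu>: "\<mu> \<in> spectrum (flux_jacobian \<Gamma> i U)"
      "spectral_radius (flux_jacobian \<Gamma> i U) = cmod \<mu>"
    by fastforce
  then obtain w where w: "w \<in> carrier_vec 8" "w \<noteq> 0\<^sub>v 8" "flux_jacobian \<Gamma> i U *\<^sub>v w = \<mu> \<cdot>\<^sub>v w"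
    by (auto simp: spectrum_def eigenvalue_def eigenvector_def flux_jacobian_def)
  obtain x y where xy: "w = complex_vec x y" using w ex_complex_vec by blast
  have "(x, y) \<noteq> (0, 0)" using w zero_complex_vec xy by auto
  moreover have "Complex (L x $ r) (L y $ r) = \<mu> * Complex (x $ r) (y $ r)" for r
  proof -
    obtain k where k: "k < 8" "r = of_nat (Suc k)"
      by (rule of_nat_Suc_8_cases)
    have "vec_index (complex_vec (L x) (L y)) k = vec_index (\<mu> \<cdot>\<^sub>v complex_vec x y) k"
      using w(3) unfolding xy flux_jacobian_mult[OF der] by simp
    then show ?thesis using k by (simp add: complex_vec_def)
  qed
  ultimately show ?thesis using bound \<mu> by metis
qed

section \<open>Uniqueness of the primitive variables\<close>

text \<open>
  The squared speed as a function of \<open>Q = \<rho> h W\<^sup>2\<close>, where \<open>S = m \<bullet> m\<close>, \<open>\<tau> = m \<bullet> B\<close> and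
  \<open>N = B \<bullet> B\<close>: it comes from \<open>(Q + N) v = m + (\<tau> / Q) B\<close>. The usual expression
  \<open>(S + (2 Q + N) \<tau>\<^sup>2 / Q\<^sup>2) / (Q + N)\<^sup>2\<close> is split into terms each of which decreases in \<open>Q\<close>.
\<close>

definition speed_sq :: "real \<Rightarrow> real \<Rightarrow> real \<Rightarrow> real \<Rightarrow> real" where
  "speed_sq S \<tau> N Q = S / (Q + N)\<^sup>2 + \<tau>\<^sup>2 * (1 / (Q * (Q + N)\<^sup>2) + 1 / (Q\<^sup>2 * (Q + N)))"

text \<open>
  The total energy that results when all primitive variables are recovered from \<open>D\<close>, \<open>m\<close>, \<open>B\<close> and a
  tentative value \<open>Q\<close> of \<open>\<rho> h W\<^sup>2\<close>; here \<open>s\<close> stands for \<open>1 / W\<^sup>2\<close>, and the term with the factor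
  \<open>(\<Gamma> - 1) / \<Gamma>\<close> is the pressure.
\<close>

definition energy_of_enthalpy :: "real \<Rightarrow> real \<Rightarrow> real \<Rightarrow> real \<Rightarrow> real \<Rightarrow> real \<Rightarrow> real" where
  "energy_of_enthalpy \<Gamma> D S \<tau> N Q = (let s = 1 - speed_sq S \<tau> N Q in
     Q - (\<Gamma> - 1) / \<Gamma> * (Q * s - D * sqrt s) + N - (N * s + \<tau>\<^sup>2 / Q\<^sup>2) / 2)"

lemma speed_sq_nonneg: "0 < Q \<Longrightarrow> 0 \<le> N \<Longrightarrow> 0 \<le> S \<Longrightarrow> 0 \<le> speed_sq S \<tau> N Q"
  unfolding speed_sq_def by simp

lemma speed_sq_antimono:
  assumes "0 < a" "a \<le> b" "0 \<le> N" "0 \<le> S"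
  shows "speed_sq S \<tau> N b \<le> speed_sq S \<tau> N a"
  unfolding speed_sq_def using assms
  by (intro add_mono mult_left_mono divide_left_mono mult_mono power_mono mult_pos_pos) auto

lemma speed_sq_deriv:
  assumes "0 < Q" "0 \<le> N"
  shows "(speed_sq S \<tau> N has_real_derivative
    - (2 * speed_sq S \<tau> N Q / (Q + N) + 2 * \<tau>\<^sup>2 / (Q ^ 3 * (Q + N)))) (at Q)"
proof -
  have nz: "Q \<noteq> 0" "Q + N \<noteq> 0" using assms by auto
  let ?M = "Q + N"
  have D1: "((\<lambda>x. S / (x + N)\<^sup>2) has_real_derivative - (2 * S / ?M ^ 3)) (at Q)"
  proof -
    have "((\<lambda>x. S / (x + N)\<^sup>2) has_real_derivative - (S * (2 * ?M)) / (?M\<^sup>2)\<^sup>2) (at Q)"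
      using nz by (auto intro!: derivative_eq_intros simp: power2_eq_square)
    moreover have "- (S * (2 * ?M)) / (?M\<^sup>2)\<^sup>2 = - (2 * S / ?M ^ 3)"
    proof -
      define M where "M = ?M"
      have "M \<noteq> 0" using nz M_def by simp
      then show ?thesis unfolding M_def[symmetric]
        by (simp add: power2_eq_square power3_eq_cube mult.assoc)
    qed
    ultimately show ?thesis by simp
  qed
  have D2: "((\<lambda>x. 1 / (x * (x + N)\<^sup>2)) has_real_derivative - (1 / (Q\<^sup>2 * ?M\<^sup>2) + 2 / (Q * ?M ^ 3))) (at Q)"
  proof -
    have "((\<lambda>x. 1 / (x * (x + N)\<^sup>2)) has_real_derivative - (?M\<^sup>2 + Q * (2 * ?M)) / (Q * ?M\<^sup>2)\<^sup>2) (at Q)"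
      using nz by (auto intro!: derivative_eq_intros simp: power2_eq_square)
    moreover have "- (?M\<^sup>2 + Q * (2 * ?M)) / (Q * ?M\<^sup>2)\<^sup>2 = - (1 / (Q\<^sup>2 * ?M\<^sup>2) + 2 / (Q * ?M ^ 3))"
    proof -
      define M where "M = ?M"
      have "M \<noteq> 0" using nz M_def by simp
      then show ?thesis unfolding M_def[symmetric] using nz(1)
        by (simp add: divide_simps) (simp add: power2_eq_square power3_eq_cube power4_eq_xxxx algebra_simps)
    qed
    ultimately show ?thesis by simp
  qed
  have D3: "((\<lambda>x. 1 / (x\<^sup>2 * (x + N))) has_real_derivative - (2 / (Q ^ 3 * ?M) + 1 / (Q\<^sup>2 * ?M\<^sup>2))) (at Q)"
  proof -
    have "((\<lambda>x. 1 / (x\<^sup>2 * (x + N))) has_real_derivative - (2 * Q * ?M + Q\<^sup>2) / (Q\<^sup>2 * ?M)\<^sup>2) (at Q)"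
      using nz by (auto intro!: derivative_eq_intros simp: power2_eq_square)
    moreover have "- (2 * Q * ?M + Q\<^sup>2) / (Q\<^sup>2 * ?M)\<^sup>2 = - (2 / (Q ^ 3 * ?M) + 1 / (Q\<^sup>2 * ?M\<^sup>2))"
    proof -
      define M where "M = ?M"
      have "M \<noteq> 0" using nz M_def by simp
      then show ?thesis unfolding M_def[symmetric] using nz(1)
        by (simp add: divide_simps) (simp add: power2_eq_square power3_eq_cube power4_eq_xxxx algebra_simps)
    qed
    ultimately show ?thesis by simp
  qed
  have "((\<lambda>x. S / (x + N)\<^sup>2 + \<tau>\<^sup>2 * (1 / (x * (x + N)\<^sup>2) + 1 / (x\<^sup>2 * (x + N)))) has_real_derivative
      - (2 * S / ?M ^ 3) + \<tau>\<^sup>2 * (- (1 / (Q\<^sup>2 * ?M\<^sup>2) + 2 / (Q * ?M ^ 3))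
        + - (2 / (Q ^ 3 * ?M) + 1 / (Q\<^sup>2 * ?M\<^sup>2)))) (at Q)"
    by (intro DERIV_add DERIV_cmult D1 D2 D3)
  moreover have "- (2 * S / ?M ^ 3) + \<tau>\<^sup>2 * (- (1 / (Q\<^sup>2 * ?M\<^sup>2) + 2 / (Q * ?M ^ 3))
        + - (2 / (Q ^ 3 * ?M) + 1 / (Q\<^sup>2 * ?M\<^sup>2))) =
      - (2 * speed_sq S \<tau> N Q / (Q + N) + 2 * \<tau>\<^sup>2 / (Q ^ 3 * (Q + N)))"
    unfolding speed_sq_def
  proof -
    define M where "M = ?M"
    have "M \<noteq> 0" using nz M_def by simp
    then show "- (2 * S / ?M ^ 3) + \<tau>\<^sup>2 * (- (1 / (Q\<^sup>2 * ?M\<^sup>2) + 2 / (Q * ?M ^ 3))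
        + - (2 / (Q ^ 3 * ?M) + 1 / (Q\<^sup>2 * ?M\<^sup>2))) =
      - (2 * (S / (Q + N)\<^sup>2 + \<tau>\<^sup>2 * (1 / (Q * (Q + N)\<^sup>2) + 1 / (Q\<^sup>2 * (Q + N)))) / (Q + N) + 2 * \<tau>\<^sup>2 / (Q ^ 3 * (Q + N)))"
      unfolding M_def[symmetric] using nz(1)
      by (simp add: divide_simps) (simp add: power2_eq_square power3_eq_cube algebra_simps)
  qed
  ultimately show ?thesis unfolding speed_sq_def by simp
qed

text \<open>
  This is where \<open>\<Gamma> \<le> 2\<close> enters: then the factor \<open>(\<Gamma> - 1) / \<Gamma>\<close> is at most \<open>1/2\<close>, and with this
  value, after dropping the term that contains \<open>D\<close>, the derivative collapses to half of
  \<open>1 - speed_sq S \<tau> N Q\<close>.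
\<close>

lemma energy_of_enthalpy_deriv_pos:
  assumes \<Gamma>: "1 < \<Gamma>" "\<Gamma> \<le> 2" and pos: "0 < Q" "0 \<le> N" "0 \<le> S" "0 < D" and sub: "speed_sq S \<tau> N Q < 1"
  shows "\<exists>y>0. (energy_of_enthalpy \<Gamma> D S \<tau> N has_real_derivative y) (at Q)"
proof -
  define k where "k = (\<Gamma> - 1) / \<Gamma>"
  define w where "w = speed_sq S \<tau> N Q"
  define M where "M = Q + N"
  define s' where "s' = 2 * w / M + 2 * \<tau>\<^sup>2 / (Q ^ 3 * M)"
  have k: "0 < k" "k \<le> 1/2" using \<Gamma> by (auto simp: k_def field_simps)
  have w: "0 \<le> w" "w < 1" using sub speed_sq_nonneg pos by (auto simp: w_def)
  have M: "M > 0" "Q \<le> M" using pos by (auto simp: M_def)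
  have s'0: "0 \<le> s'" using w M pos by (simp add: s'_def)
  have ds: "((\<lambda>x. 1 - speed_sq S \<tau> N x) has_real_derivative s') (at Q)"
    using DERIV_diff[OF DERIV_const[of 1] speed_sq_deriv[OF pos(1,2), of S \<tau>]]
    unfolding s'_def w_def M_def by (simp add: add.commute)
  have dsq: "((\<lambda>x. sqrt (1 - speed_sq S \<tau> N x)) has_real_derivative s' / (2 * sqrt (1 - w))) (at Q)"
    using DERIV_chain2[OF DERIV_real_sqrt ds] w unfolding w_def by (simp add: field_simps)
  let ?y = "1 - k * ((1 - w) + Q * s' - D * (s' / (2 * sqrt (1 - w)))) - (N * s' - 2 * \<tau>\<^sup>2 / Q ^ 3) / 2"
  have dt: "((\<lambda>x. \<tau>\<^sup>2 / x\<^sup>2) has_real_derivative - 2 * \<tau>\<^sup>2 / Q ^ 3) (at Q)"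
    using pos by (auto intro!: derivative_eq_intros simp: field_simps power2_eq_square power3_eq_cube)
  have "(energy_of_enthalpy \<Gamma> D S \<tau> N has_real_derivative ?y) (at Q)"
    unfolding energy_of_enthalpy_def Let_def k_def[symmetric]
  proof -
    have gen: "((\<lambda>x. x - k * (x * s x - D * q x) + N - (N * s x + t x) / 2) has_real_derivative
        1 - k * (1 * s Q + a * Q - D * b) + 0 - (N * a + c) / 2) (at Q)"
      if "(s has_real_derivative a) (at Q)" "(q has_real_derivative b) (at Q)"
        "(t has_real_derivative c) (at Q)" for s q t a b c
      by (intro DERIV_diff DERIV_add DERIV_mult DERIV_cmult DERIV_ident DERIV_const DERIV_cdivide that)
    show "((\<lambda>x. x - k * (x * (1 - speed_sq S \<tau> N x) - D * sqrt (1 - speed_sq S \<tau> N x)) + N -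
        (N * (1 - speed_sq S \<tau> N x) + \<tau>\<^sup>2 / x\<^sup>2) / 2) has_real_derivative ?y) (at Q)"
      by (rule DERIV_cong[OF gen[OF ds dsq dt]]) (simp add: w_def mult.commute)
  qed
  moreover have "?y > 0"
  proof -
    have a: "k * ((1 - w) + Q * s' - D * (s' / (2 * sqrt (1 - w)))) \<le> 1/2 * ((1 - w) + Q * s')"
    proof -
      have "k * ((1 - w) + Q * s' - D * (s' / (2 * sqrt (1 - w)))) \<le> k * ((1 - w) + Q * s')"
        using k pos s'0 w by (intro mult_left_mono) auto
      also have "\<dots> \<le> 1/2 * ((1 - w) + Q * s')"
        using k pos s'0 w by (intro mult_right_mono) auto
      finally show ?thesis .
    qed
    have N: "N = M - Q" by (simp add: M_def)
    have e: "1 - 1/2 * ((1 - w) + Q * s') - (N * s' - 2 * \<tau>\<^sup>2 / Q ^ 3) / 2 = (1 - w) / 2"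
      unfolding s'_def N using M pos
      by (simp add: divide_simps) (simp add: power2_eq_square power3_eq_cube algebra_simps)
    have "(1 - w) / 2 \<le> ?y"
      unfolding e[symmetric] by (intro diff_right_mono diff_left_mono a)
    moreover have "0 < (1 - w) / 2" using w by simp
    ultimately show ?thesis by (rule less_le_trans[rotated])
  qed
  ultimately show ?thesis by blast
qed

text \<open>
  The speed decreases in \<open>Q\<close>, so the whole interval to the right of a subluminal value is subluminal and
  the derivative is positive along it.
\<close>

lemma energy_of_enthalpy_strict_mono:
  assumes \<Gamma>: "1 < \<Gamma>" "\<Gamma> \<le> 2" and pos: "0 < a" "a < b" "0 \<le> N" "0 \<le> S" "0 < D"
    and sub: "speed_sq S \<tau> N a < 1"
  shows "energy_of_enthalpy \<Gamma> D S \<tau> N a < energy_of_enthalpy \<Gamma> D S \<tau> N b"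
proof (rule DERIV_pos_imp_increasing[OF pos(2)])
  fix x assume x: "a \<le> x" "x \<le> b"
  then have "speed_sq S \<tau> N x < 1" using speed_sq_antimono[of a x N S \<tau>] pos sub by linarith
  then show "\<exists>y. (energy_of_enthalpy \<Gamma> D S \<tau> N has_real_derivative y) (at x) \<and> 0 < y"
    using energy_of_enthalpy_deriv_pos[OF \<Gamma>, of x N S D \<tau>] x pos by auto
qed

text \<open>
  This is \<open>\<rho> h W\<^sup>2\<close> under the \<open>\<Gamma>\<close>-law, rewritten without a division by \<open>\<rho>\<close>.
\<close>

definition total_enthalpy :: "real \<Rightarrow> real \<Rightarrow> real ^ 3 \<Rightarrow> real \<Rightarrow> real" where
  "total_enthalpy \<Gamma> \<rho> v p = (\<rho> + \<Gamma> / (\<Gamma> - 1) * p) / (1 - v \<bullet> v)"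

text \<open>
  The conservative variables and the flux with the Lorentz factor eliminated, in a form that is
  differentiable term by term.
\<close>

definition cons_blocks :: "real \<Rightarrow> prim_state \<Rightarrow> prim_state" where
  "cons_blocks \<Gamma> = (\<lambda>(\<rho>, v, B, p). let Q = total_enthalpy \<Gamma> \<rho> v p in
     (\<rho> / sqrt (1 - v \<bullet> v), (Q + B \<bullet> B) *\<^sub>R v - (v \<bullet> B) *\<^sub>R B, B,
      Q - p - (B \<bullet> B * (1 - v \<bullet> v) + (v \<bullet> B)\<^sup>2) / 2 + B \<bullet> B))"

definition flux_blocks :: "real \<Rightarrow> 3 \<Rightarrow> prim_state \<Rightarrow> prim_state" where
  "flux_blocks \<Gamma> i = (\<lambda>(\<rho>, v, B, p). let m = (total_enthalpy \<Gamma> \<rho> v p + B \<bullet> B) *\<^sub>R v - (v \<bullet> B) *\<^sub>R B in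
     (\<rho> / sqrt (1 - v \<bullet> v) * v $ i,
      v $ i *\<^sub>R m - B $ i *\<^sub>R ((1 - v \<bullet> v) *\<^sub>R B + (v \<bullet> B) *\<^sub>R v)
        + (p + (B \<bullet> B * (1 - v \<bullet> v) + (v \<bullet> B)\<^sup>2) / 2) *\<^sub>R axis i 1,
      v $ i *\<^sub>R B - B $ i *\<^sub>R v,
      m $ i))"

lemma admissible_prims_iff:
  "(\<rho>, v, B, p) \<in> admissible_prims \<longleftrightarrow> 0 < \<rho> \<and> 0 < p \<and> v \<bullet> v < 1"
  by (simp add: admissible_prims_def norm_eq_sqrt_inner)

lemma lorentz_simps:
  assumes "v \<bullet> v < 1"
  shows "lorentz v = 1 / sqrt (1 - v \<bullet> v)" "(lorentz v)\<^sup>2 = 1 / (1 - v \<bullet> v)"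
  using assms by (simp_all add: lorentz_def power2_norm_eq_inner power_divide)

lemma cons_flux_of_prim_eq:
  assumes \<Gamma>: "1 < \<Gamma>" and V: "V \<in> admissible_prims"
  shows "cons_of_prim \<Gamma> V = of_blocks (cons_blocks \<Gamma> V)"
    and "flux_of_prim \<Gamma> i V = of_blocks (flux_blocks \<Gamma> i V)"
proof -
  obtain \<rho> v B p where Ve: "V = (\<rho>, v, B, p)" by (cases V)
  have adm: "0 < \<rho>" "0 < p" "v \<bullet> v < 1" using V by (auto simp: Ve admissible_prims_iff)
  have h: "\<rho> * enthalpy \<Gamma> \<rho> p * (1 / (1 - v \<bullet> v)) = total_enthalpy \<Gamma> \<rho> v p"
  proof -
    have "1 / (\<Gamma> - 1) + 1 = \<Gamma> / (\<Gamma> - 1)" using \<Gamma> by (simp add: field_simps)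
    then have "\<rho> * enthalpy \<Gamma> \<rho> p = \<rho> + \<Gamma> / (\<Gamma> - 1) * p"
      using adm \<Gamma> by (simp add: enthalpy_def internal_energy_def field_simps)
    then show ?thesis by (simp add: total_enthalpy_def)
  qed
  have pm: "magnetic_pressure v B = (B \<bullet> B * (1 - v \<bullet> v) + (v \<bullet> B)\<^sup>2) / 2"
    unfolding magnetic_pressure_def lorentz_simps(2)[OF adm(3)] by (simp add: power2_norm_eq_inner)
  have m: "momentum \<Gamma> (\<rho>, v, B, p) = (total_enthalpy \<Gamma> \<rho> v p + B \<bullet> B) *\<^sub>R v - (v \<bullet> B) *\<^sub>R B"
    using adm h by (simp add: momentum_def lorentz_simps(2) power2_norm_eq_inner scaleR_left_distrib)
  have E: "energy \<Gamma> (\<rho>, v, B, p) =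
      total_enthalpy \<Gamma> \<rho> v p - p - (B \<bullet> B * (1 - v \<bullet> v) + (v \<bullet> B)\<^sup>2) / 2 + B \<bullet> B"
    using h by (simp add: energy_def lorentz_simps(2)[OF adm(3)] pm power2_norm_eq_inner)
  show "cons_of_prim \<Gamma> V = of_blocks (cons_blocks \<Gamma> V)"
    unfolding Ve cons_of_prim_def cons_blocks_def of_blocks_def Let_def prod.case m E
    using adm by (simp add: mass_density_def lorentz_simps)
  show "flux_of_prim \<Gamma> i V = of_blocks (flux_blocks \<Gamma> i V)"
    unfolding Ve flux_of_prim_def flux_blocks_def of_blocks_def Let_def prod.case m pm lorentz_simps(2)[OF adm(3)]
    using adm by (simp add: mass_density_def lorentz_simps(1))
qed

lemma total_enthalpy_pos:
  assumes "1 < \<Gamma>" "0 < \<rho>" "0 < p" "v \<bullet> v < 1"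
  shows "0 < total_enthalpy \<Gamma> \<rho> v p"
  using assms by (simp add: total_enthalpy_def add_pos_pos)

text \<open>
  Every primitive quantity is determined by the conservative vector together with \<open>Q\<close>, and \<open>Q\<close> solves
  the scalar equation that equates the recovered energy with \<open>E\<close>.
\<close>

lemma cons_blocks_recover:
  assumes \<Gamma>: "1 < \<Gamma>" and adm: "0 < \<rho>" "0 < p" "v \<bullet> v < 1"
    and c: "cons_blocks \<Gamma> (\<rho>, v, B, p) = (D, m, B', E)"
  defines "Q \<equiv> total_enthalpy \<Gamma> \<rho> v p"
  shows "B' = B" "m \<bullet> B = Q * (v \<bullet> B)" "(Q + B \<bullet> B) *\<^sub>R v = m + (v \<bullet> B) *\<^sub>R B"
    "speed_sq (m \<bullet> m) (m \<bullet> B) (B \<bullet> B) Q = v \<bullet> v"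
    "\<rho> = D * sqrt (1 - v \<bullet> v)" "p = (\<Gamma> - 1) / \<Gamma> * (Q * (1 - v \<bullet> v) - \<rho>)"
    "energy_of_enthalpy \<Gamma> D (m \<bullet> m) (m \<bullet> B) (B \<bullet> B) Q = E"
proof -
  have Q0: "0 < Q" unfolding Q_def by (rule total_enthalpy_pos[OF \<Gamma> adm])
  note c' = c[unfolded cons_blocks_def Let_def prod.case Q_def[symmetric] prod.inject]
  show "B' = B" using c' by simp
  have m: "m = (Q + B \<bullet> B) *\<^sub>R v - (v \<bullet> B) *\<^sub>R B" using c' by blast
  have E: "E = Q - p - (B \<bullet> B * (1 - v \<bullet> v) + (v \<bullet> B)\<^sup>2) / 2 + B \<bullet> B" using c' by blast
  show mB: "m \<bullet> B = Q * (v \<bullet> B)" unfolding m by (simp add: inner_diff_left algebra_simps)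
  show "(Q + B \<bullet> B) *\<^sub>R v = m + (v \<bullet> B) *\<^sub>R B" by (simp add: m)
  have S: "m \<bullet> m = (Q + B \<bullet> B)\<^sup>2 * (v \<bullet> v) - (2 * Q + B \<bullet> B) * (v \<bullet> B)\<^sup>2"
    unfolding m by (simp add: inner_diff_left inner_diff_right inner_commute power2_eq_square algebra_simps)
  show sp: "speed_sq (m \<bullet> m) (m \<bullet> B) (B \<bullet> B) Q = v \<bullet> v"
  proof -
    define M where "M = Q + B \<bullet> B"
    have M: "M > 0" unfolding M_def using Q0 inner_ge_zero[of B] by linarith
    have B: "B \<bullet> B = M - Q" by (simp add: M_def)
    show ?thesis
      unfolding speed_sq_def mB S M_def[symmetric] unfolding B using M Q0
      by (simp add: divide_simps) (simp add: power2_eq_square algebra_simps)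
  qed
  show \<rho>: "\<rho> = D * sqrt (1 - v \<bullet> v)" using c' adm by auto
  have "Q * (1 - v \<bullet> v) = \<rho> + \<Gamma> / (\<Gamma> - 1) * p" using adm by (simp add: Q_def total_enthalpy_def)
  then show p: "p = (\<Gamma> - 1) / \<Gamma> * (Q * (1 - v \<bullet> v) - \<rho>)" using \<Gamma> by simp
  show "energy_of_enthalpy \<Gamma> D (m \<bullet> m) (m \<bullet> B) (B \<bullet> B) Q = E"
    unfolding energy_of_enthalpy_def Let_def sp \<rho>[symmetric] p[symmetric] unfolding mB
    using Q0 by (simp add: E power_mult_distrib)
qed

text \<open>
  Two values of \<open>Q\<close> for the same vector would give the same energy, against strict monotonicity.
\<close>

lemma cons_blocks_inj:
  assumes \<Gamma>: "1 < \<Gamma>" "\<Gamma> \<le> 2"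
  shows "inj_on (cons_blocks \<Gamma>) admissible_prims"
proof (rule inj_onI)
  fix V1 V2 assume V: "V1 \<in> admissible_prims" "V2 \<in> admissible_prims"
    and eq: "cons_blocks \<Gamma> V1 = cons_blocks \<Gamma> V2"
  obtain D m B E where c: "cons_blocks \<Gamma> V1 = (D, m, B, E)" by (cases "cons_blocks \<Gamma> V1")
  obtain \<rho>1 v1 B1 p1 where V1: "V1 = (\<rho>1, v1, B1, p1)" by (cases V1)
  obtain \<rho>2 v2 B2 p2 where V2: "V2 = (\<rho>2, v2, B2, p2)" by (cases V2)
  have a1: "0 < \<rho>1" "0 < p1" "v1 \<bullet> v1 < 1" and a2: "0 < \<rho>2" "0 < p2" "v2 \<bullet> v2 < 1"
    using V by (auto simp: V1 V2 admissible_prims_iff)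
  define Q1 where "Q1 = total_enthalpy \<Gamma> \<rho>1 v1 p1"
  define Q2 where "Q2 = total_enthalpy \<Gamma> \<rho>2 v2 p2"
  note r1 = cons_blocks_recover[OF \<Gamma>(1) a1 c[unfolded V1], folded Q1_def]
  note r2 = cons_blocks_recover[OF \<Gamma>(1) a2 c[unfolded eq V2], folded Q2_def]
  have B: "B1 = B" "B2 = B" using r1(1) r2(1) by auto
  note r1 = r1[unfolded B] and r2 = r2[unfolded B]
  have D: "0 < D" using r1(5) a1 by (auto simp: zero_less_mult_iff)
  have Q: "0 < Q1" "0 < Q2" unfolding Q1_def Q2_def using total_enthalpy_pos \<Gamma> a1 a2 by auto
  have "Q1 = Q2"
  proof (rule ccontr)
    assume "Q1 \<noteq> Q2"
    then consider "Q1 < Q2" | "Q2 < Q1" by linarith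
    then show False
    proof cases
      case 1
      then show False
        using energy_of_enthalpy_strict_mono[OF \<Gamma> Q(1) 1, of "B \<bullet> B" "m \<bullet> m" D "m \<bullet> B"]
          r1(4,7) r2(7) D a1 by simp
    next
      case 2
      then show False
        using energy_of_enthalpy_strict_mono[OF \<Gamma> Q(2) 2, of "B \<bullet> B" "m \<bullet> m" D "m \<bullet> B"]
          r2(4,7) r1(7) D a2 by simp
    qed
  qed
  then have "v1 \<bullet> B = v2 \<bullet> B" using r1(2) r2(2) Q by simp
  then have "(Q1 + B \<bullet> B) *\<^sub>R v1 = (Q1 + B \<bullet> B) *\<^sub>R v2" using r1(3) r2(3) \<open>Q1 = Q2\<close> by simp
  moreover have "Q1 + B \<bullet> B \<noteq> 0" using Q(1) inner_ge_zero[of B] by linarith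
  ultimately have v: "v1 = v2" by simp
  then have \<rho>: "\<rho>1 = \<rho>2" using r1(5) r2(5) by simp
  then have "p1 = p2" using r1(6) r2(6) v \<open>Q1 = Q2\<close> by simp
  then show "V1 = V2" using v \<rho> B by (simp add: V1 V2)
qed

section \<open>Derivative of the flux with respect to the conservative variables\<close>

text \<open>
  In the derivatives below, \<open>(r, u, b, q)\<close> is a variation of the primitive state \<open>(\<rho>, v, B, p)\<close>.
\<close>

definition d_total_enthalpy :: "real \<Rightarrow> prim_state \<Rightarrow> prim_state \<Rightarrow> real" where
  "d_total_enthalpy \<Gamma> = (\<lambda>(\<rho>, v, B, p) (r, u, b, q). let s = 1 - v \<bullet> v in
     (r + \<Gamma> / (\<Gamma> - 1) * q) / s + (\<rho> + \<Gamma> / (\<Gamma> - 1) * p) * (2 * (v \<bullet> u)) / s\<^sup>2)"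

definition d_mass_density :: "prim_state \<Rightarrow> prim_state \<Rightarrow> real" where
  "d_mass_density = (\<lambda>(\<rho>, v, B, p) (r, u, b, q). let s = 1 - v \<bullet> v in
     r / sqrt s + \<rho> * (v \<bullet> u) / (s * sqrt s))"

definition d_momentum :: "real \<Rightarrow> prim_state \<Rightarrow> prim_state \<Rightarrow> real ^ 3" where
  "d_momentum \<Gamma> = (\<lambda>(\<rho>, v, B, p) (r, u, b, q).
     (d_total_enthalpy \<Gamma> (\<rho>, v, B, p) (r, u, b, q) + 2 * (B \<bullet> b)) *\<^sub>R v
       + (total_enthalpy \<Gamma> \<rho> v p + B \<bullet> B) *\<^sub>R u - (u \<bullet> B + v \<bullet> b) *\<^sub>R B - (v \<bullet> B) *\<^sub>R b)"

definition d_magnetic_pressure :: "prim_state \<Rightarrow> prim_state \<Rightarrow> real" where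
  "d_magnetic_pressure = (\<lambda>(\<rho>, v, B, p) (r, u, b, q).
     B \<bullet> b * (1 - v \<bullet> v) - B \<bullet> B * (v \<bullet> u) + (v \<bullet> B) * (u \<bullet> B + v \<bullet> b))"

definition d_cons_blocks :: "real \<Rightarrow> prim_state \<Rightarrow> prim_state \<Rightarrow> prim_state" where
  "d_cons_blocks \<Gamma> = (\<lambda>(\<rho>, v, B, p) (r, u, b, q).
     (d_mass_density (\<rho>, v, B, p) (r, u, b, q),
      d_momentum \<Gamma> (\<rho>, v, B, p) (r, u, b, q),
      b,
      d_total_enthalpy \<Gamma> (\<rho>, v, B, p) (r, u, b, q) - q
        - d_magnetic_pressure (\<rho>, v, B, p) (r, u, b, q) + 2 * (B \<bullet> b)))"

definition d_flux_blocks :: "real \<Rightarrow> 3 \<Rightarrow> prim_state \<Rightarrow> prim_state \<Rightarrow> prim_state" where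
  "d_flux_blocks \<Gamma> i = (\<lambda>(\<rho>, v, B, p) (r, u, b, q).
     let m = (total_enthalpy \<Gamma> \<rho> v p + B \<bullet> B) *\<^sub>R v - (v \<bullet> B) *\<^sub>R B;
         dm = d_momentum \<Gamma> (\<rho>, v, B, p) (r, u, b, q)
     in
     (d_mass_density (\<rho>, v, B, p) (r, u, b, q) * v $ i + \<rho> / sqrt (1 - v \<bullet> v) * u $ i,
      u $ i *\<^sub>R m + v $ i *\<^sub>R dm - b $ i *\<^sub>R ((1 - v \<bullet> v) *\<^sub>R B + (v \<bullet> B) *\<^sub>R v)
        - B $ i *\<^sub>R ((1 - v \<bullet> v) *\<^sub>R b - (2 * (v \<bullet> u)) *\<^sub>R B + (u \<bullet> B + v \<bullet> b) *\<^sub>R v + (v \<bullet> B) *\<^sub>R u)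
        + (q + d_magnetic_pressure (\<rho>, v, B, p) (r, u, b, q)) *\<^sub>R axis i 1,
      u $ i *\<^sub>R B + v $ i *\<^sub>R b - b $ i *\<^sub>R v - B $ i *\<^sub>R u,
      dm $ i))"

lemma has_derivative_nth:
  "(f has_derivative f') F \<Longrightarrow> ((\<lambda>x. f x $ i) has_derivative (\<lambda>h. f' h $ i)) F"
  by (rule bounded_linear.has_derivative[OF bounded_linear_vec_nth])

lemma cons_flux_blocks_has_derivative:
  fixes V :: prim_state
  assumes V: "V \<in> admissible_prims"
  shows "(cons_blocks \<Gamma> has_derivative d_cons_blocks \<Gamma> V) (at V)"
    and "(flux_blocks \<Gamma> i has_derivative d_flux_blocks \<Gamma> i V) (at V)"
proof -
  let ?\<rho> = "\<lambda>Y::prim_state. fst Y" let ?v = "\<lambda>Y::prim_state. fst (snd Y)"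
  let ?B = "\<lambda>Y::prim_state. fst (snd (snd Y))" let ?p = "\<lambda>Y::prim_state. snd (snd (snd Y))"
  have d0: "(?\<rho> has_derivative ?\<rho>) (at V)" "(?v has_derivative ?v) (at V)"
    "(?B has_derivative ?B) (at V)" "(?p has_derivative ?p) (at V)"
    by (auto intro!: derivative_eq_intros)
  have sV: "0 < 1 - ?v V \<bullet> ?v V" using V by (cases V) (simp add: admissible_prims_iff)
  have ds: "((\<lambda>Y. 1 - ?v Y \<bullet> ?v Y) has_derivative (\<lambda>X. - (2 * (?v V \<bullet> ?v X)))) (at V)"
    by (rule derivative_eq_intros d0 refl)+ (simp add: inner_commute)
  have dN: "((\<lambda>Y. ?B Y \<bullet> ?B Y) has_derivative (\<lambda>X. 2 * (?B V \<bullet> ?B X))) (at V)"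
    by (rule derivative_eq_intros d0 refl)+ (simp add: inner_commute)
  have dt: "((\<lambda>Y. ?v Y \<bullet> ?B Y) has_derivative (\<lambda>X. ?v X \<bullet> ?B V + ?v V \<bullet> ?B X)) (at V)"
    by (rule derivative_eq_intros d0 refl)+ (simp add: add.commute)
  have dQ: "((\<lambda>Y. total_enthalpy \<Gamma> (?\<rho> Y) (?v Y) (?p Y)) has_derivative d_total_enthalpy \<Gamma> V) (at V)"
    unfolding total_enthalpy_def
    by (rule derivative_eq_intros d0 ds refl)+
      (use sV in \<open>auto simp: d_total_enthalpy_def Let_def split_beta fun_eq_iff divide_simps power2_eq_square\<close>)
  have dD: "((\<lambda>Y. ?\<rho> Y / sqrt (1 - ?v Y \<bullet> ?v Y)) has_derivative d_mass_density V) (at V)"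
    by (rule derivative_eq_intros d0 ds refl sV)+
      (use sV in \<open>auto simp: d_mass_density_def Let_def split_beta fun_eq_iff divide_simps power2_eq_square\<close>)
  have dm: "((\<lambda>Y. (total_enthalpy \<Gamma> (?\<rho> Y) (?v Y) (?p Y) + ?B Y \<bullet> ?B Y) *\<^sub>R ?v Y - (?v Y \<bullet> ?B Y) *\<^sub>R ?B Y)
      has_derivative d_momentum \<Gamma> V) (at V)"
    by (rule derivative_eq_intros d0 dN dt dQ refl)+
      (auto simp: d_momentum_def split_beta fun_eq_iff algebra_simps)
  have dpm: "((\<lambda>Y. (?B Y \<bullet> ?B Y * (1 - ?v Y \<bullet> ?v Y) + (?v Y \<bullet> ?B Y)\<^sup>2) / 2)
      has_derivative d_magnetic_pressure V) (at V)"
  proof -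
    have "((\<lambda>Y. (N Y * s Y + (t Y)\<^sup>2) / 2) has_derivative
        (\<lambda>X. (N V * s' X + N' X * s V + 2 * (t V * t' X)) / 2)) (at V)"
      if "(N has_derivative N') (at V)" "(s has_derivative s') (at V)" "(t has_derivative t') (at V)"
      for N s t N' s' t' :: "prim_state \<Rightarrow> real"
      by (rule derivative_eq_intros that refl)+ (auto simp: fun_eq_iff mult_ac)
    from this[OF dN ds dt] show ?thesis
      by (rule has_derivative_eq_rhs)
        (auto simp: d_magnetic_pressure_def split_beta fun_eq_iff field_simps)
  qed
  have dE: "((\<lambda>Y. total_enthalpy \<Gamma> (?\<rho> Y) (?v Y) (?p Y) - ?p Y
        - (?B Y \<bullet> ?B Y * (1 - ?v Y \<bullet> ?v Y) + (?v Y \<bullet> ?B Y)\<^sup>2) / 2 + ?B Y \<bullet> ?B Y)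
      has_derivative (\<lambda>X. d_total_enthalpy \<Gamma> V X - ?p X - d_magnetic_pressure V X + 2 * (?B V \<bullet> ?B X))) (at V)"
    by (intro has_derivative_add has_derivative_diff dQ d0 dpm dN)
  have "((\<lambda>Y. (?\<rho> Y / sqrt (1 - ?v Y \<bullet> ?v Y),
      (total_enthalpy \<Gamma> (?\<rho> Y) (?v Y) (?p Y) + ?B Y \<bullet> ?B Y) *\<^sub>R ?v Y - (?v Y \<bullet> ?B Y) *\<^sub>R ?B Y, ?B Y,
      total_enthalpy \<Gamma> (?\<rho> Y) (?v Y) (?p Y) - ?p Y
        - (?B Y \<bullet> ?B Y * (1 - ?v Y \<bullet> ?v Y) + (?v Y \<bullet> ?B Y)\<^sup>2) / 2 + ?B Y \<bullet> ?B Y))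
    has_derivative (\<lambda>X. (d_mass_density V X, d_momentum \<Gamma> V X, ?B X,
      d_total_enthalpy \<Gamma> V X - ?p X - d_magnetic_pressure V X + 2 * (?B V \<bullet> ?B X)))) (at V)"
    by (intro has_derivative_Pair dD dm d0 dE)
  then show "(cons_blocks \<Gamma> has_derivative d_cons_blocks \<Gamma> V) (at V)"
    unfolding cons_blocks_def d_cons_blocks_def Let_def split_beta by simp
  define s where "s = (\<lambda>Y. 1 - ?v Y \<bullet> ?v Y)"
  define t where "t = (\<lambda>Y. ?v Y \<bullet> ?B Y)"
  define t' where "t' = (\<lambda>X. ?v X \<bullet> ?B V + ?v V \<bullet> ?B X)"
  define s' where "s' = (\<lambda>X. - (2 * (?v V \<bullet> ?v X)))"
  define D where "D = (\<lambda>Y. ?\<rho> Y / sqrt (1 - ?v Y \<bullet> ?v Y))"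
  define m where "m = (\<lambda>Y. (total_enthalpy \<Gamma> (?\<rho> Y) (?v Y) (?p Y) + ?B Y \<bullet> ?B Y) *\<^sub>R ?v Y - (?v Y \<bullet> ?B Y) *\<^sub>R ?B Y)"
  define pm where "pm = (\<lambda>Y. (?B Y \<bullet> ?B Y * (1 - ?v Y \<bullet> ?v Y) + (?v Y \<bullet> ?B Y)\<^sup>2) / 2)"
  note ds = ds[folded s_def s'_def] and dt = dt[folded t_def t'_def] and dD = dD[folded D_def]
    and dm = dm[folded m_def] and dpm = dpm[folded pm_def]
  note vi = has_derivative_nth[OF d0(2), of i] and Bi = has_derivative_nth[OF d0(3), of i]
  have "((\<lambda>Y. (D Y * ?v Y $ i,
      ?v Y $ i *\<^sub>R m Y - ?B Y $ i *\<^sub>R (s Y *\<^sub>R ?B Y + t Y *\<^sub>R ?v Y) + (?p Y + pm Y) *\<^sub>R axis i 1,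
      ?v Y $ i *\<^sub>R ?B Y - ?B Y $ i *\<^sub>R ?v Y, m Y $ i))
    has_derivative (\<lambda>X. (D V * ?v X $ i + d_mass_density V X * ?v V $ i,
      (?v V $ i *\<^sub>R d_momentum \<Gamma> V X + ?v X $ i *\<^sub>R m V)
        - (?B V $ i *\<^sub>R ((s V *\<^sub>R ?B X + s' X *\<^sub>R ?B V) + (t V *\<^sub>R ?v X + t' X *\<^sub>R ?v V))
           + ?B X $ i *\<^sub>R (s V *\<^sub>R ?B V + t V *\<^sub>R ?v V))
        + (?p X + d_magnetic_pressure V X) *\<^sub>R axis i 1,
      (?v V $ i *\<^sub>R ?B X + ?v X $ i *\<^sub>R ?B V) - (?B V $ i *\<^sub>R ?v X + ?B X $ i *\<^sub>R ?v V),
      d_momentum \<Gamma> V X $ i))) (at V)"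
    by (intro has_derivative_Pair has_derivative_add has_derivative_diff has_derivative_mult
        has_derivative_scaleR has_derivative_scaleR_left has_derivative_nth vi Bi d0 ds dt dD dm dpm)
  then show "(flux_blocks \<Gamma> i has_derivative d_flux_blocks \<Gamma> i V) (at V)"
    unfolding flux_blocks_def d_flux_blocks_def Let_def split_beta s_def t_def s'_def t'_def D_def m_def pm_def
    by (rule has_derivative_eq_rhs) (auto simp: fun_eq_iff algebra_simps)
qed

lemma open_admissible_prims: "open admissible_prims"
proof -
  have e: "admissible_prims = {V. 0 < fst V} \<inter> {V. 0 < snd (snd (snd V))} \<inter> {V. norm (fst (snd V)) < 1}"
    by (auto simp: admissible_prims_def)
  show ?thesis unfolding e by (intro open_Int open_Collect_less continuous_intros)
qed

lemma prim_of_cons_cons_of_prim: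
  assumes "1 < \<Gamma>" "\<Gamma> \<le> 2" "V \<in> admissible_prims"
  shows "prim_of_cons \<Gamma> (cons_of_prim \<Gamma> V) = V"
proof -
  have "inj_on (cons_of_prim \<Gamma>) admissible_prims"
    using cons_blocks_inj[OF assms(1,2)] cons_flux_of_prim_eq(1)[OF assms(1)]
    by (auto simp: inj_on_def of_blocks_eq_iff)
  then show ?thesis unfolding prim_of_cons_def using assms(3) by (rule inv_into_f_f)
qed

text \<open>
  The flux is explicit only in primitive variables. As the conservative map is injective on the open set of
  primitive states and its derivative at \<open>V\<close> is invertible, its inverse is differentiable, so the flux is
  differentiable at the corresponding vector. The chain rule then describes the derivative \<open>L\<close>
  through variations of primitive variables: \<open>L\<close> sends the variation of the conservative vector to
  that of the flux. Eigenvectors can therefore be sought among the primitive variations.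
\<close>

lemma flux_has_derivative:
  assumes \<Gamma>: "1 < \<Gamma>" "\<Gamma> \<le> 2" and V: "V \<in> admissible_prims"
    and ker: "\<And>X. d_cons_blocks \<Gamma> V X = 0 \<Longrightarrow> X = 0"
  shows "\<exists>L. (flux \<Gamma> i has_derivative L) (at (cons_of_prim \<Gamma> V)) \<and>
    (\<forall>X. L (of_blocks (d_cons_blocks \<Gamma> V X)) = of_blocks (d_flux_blocks \<Gamma> i V X))"
proof -
  note dC = cons_flux_blocks_has_derivative(1)[of _ \<Gamma>] and dF = cons_flux_blocks_has_derivative(2)[of _ \<Gamma> i]
  have lin: "linear (d_cons_blocks \<Gamma> V)" by (rule has_derivative_linear[OF dC[OF V]])
  have "inj (d_cons_blocks \<Gamma> V)" using ker linear_injective_0[OF lin] by blast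
  from linear_injective_isomorphism[OF lin this] obtain A where
    A: "\<And>X. A (d_cons_blocks \<Gamma> V X) = X" "\<And>X. d_cons_blocks \<Gamma> V (A X) = X" by blast
  define g where "g = (\<lambda>Z. prim_of_cons \<Gamma> (of_blocks Z))"
  have g: "g (cons_blocks \<Gamma> Y) = Y" if "Y \<in> admissible_prims" for Y
    using prim_of_cons_cons_of_prim[OF \<Gamma> that] that cons_flux_of_prim_eq(1)[OF \<Gamma>(1)]
    by (simp add: g_def)
  have dg: "(g has_derivative A) (at (cons_blocks \<Gamma> V))"
  proof (rule has_derivative_inverse_strong[OF open_admissible_prims V _ g dC[OF V]])
    show "continuous_on admissible_prims (cons_blocks \<Gamma>)"
      by (rule has_derivative_continuous_on) (use dC has_derivative_at_withinI in blast)
    show "d_cons_blocks \<Gamma> V \<circ> A = id" using A by auto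
  qed
  have "(flux_of_prim \<Gamma> i has_derivative (\<lambda>X. of_blocks (d_flux_blocks \<Gamma> i V X))) (at V)"
  proof (rule has_derivative_transform_within_open[OF _ open_admissible_prims V])
    show "((\<lambda>Y. of_blocks (flux_blocks \<Gamma> i Y)) has_derivative (\<lambda>X. of_blocks (d_flux_blocks \<Gamma> i V X))) (at V)"
      by (rule bounded_linear.has_derivative[OF linear_conv_bounded_linear[THEN iffD1, OF linear_of_blocks] dF[OF V]])
    show "of_blocks (flux_blocks \<Gamma> i Y) = flux_of_prim \<Gamma> i Y" if "Y \<in> admissible_prims" for Y
      using cons_flux_of_prim_eq(2)[OF \<Gamma>(1) that] by simp
  qed
  moreover have "(blocks has_derivative blocks) (at (cons_of_prim \<Gamma> V))"
    by (rule linear_imp_has_derivative[OF linear_blocks])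
  moreover have c: "blocks (cons_of_prim \<Gamma> V) = cons_blocks \<Gamma> V"
    by (simp add: cons_flux_of_prim_eq(1)[OF \<Gamma>(1) V])
  moreover have "g (cons_blocks \<Gamma> V) = V" using g V by blast
  ultimately have "(flux_of_prim \<Gamma> i \<circ> (g \<circ> blocks) has_derivative
      (\<lambda>X. of_blocks (d_flux_blocks \<Gamma> i V X)) \<circ> (A \<circ> blocks)) (at (cons_of_prim \<Gamma> V))"
    using dg by (intro diff_chain_at) simp_all
  moreover have "flux_of_prim \<Gamma> i \<circ> (g \<circ> blocks) = flux \<Gamma> i"
    by (simp add: fun_eq_iff flux_def g_def)
  ultimately show ?thesis by (auto simp: A intro!: exI[of _ "(\<lambda>X. of_blocks (d_flux_blocks \<Gamma> i V X)) \<circ> (A \<circ> blocks)"])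
qed

section \<open>Sufficient conditions for admissibility and the acoustic inequality\<close>

text \<open>
  The pressure is \<open>Q - E\<close> if \<open>B = 0\<close>, so a root \<open>Q > E\<close> of the energy equation \<open>\<phi> Q = 0\<close> is needed.
  At \<open>Q = E\<close> the condition \<open>D\<^sup>2 + m \<bullet> m < E\<^sup>2\<close> makes the recovered pressure positive and so
  \<open>\<phi>\<close> negative, while at \<open>Q = 2 E\<close> the factor \<open>k \<le> 1/2\<close> makes \<open>\<phi>\<close> nonnegative.
\<close>

lemma state_vec_in_admissible_set:
  assumes \<Gamma>: "1 < \<Gamma>" "\<Gamma> \<le> 2" and D: "0 < D" and E: "0 < E" "D\<^sup>2 + m \<bullet> m < E\<^sup>2"
  shows "state_vec D m 0 E \<in> admissible_set \<Gamma>"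
proof -
  define S where "S = m \<bullet> m"
  define k where "k = (\<Gamma> - 1) / \<Gamma>"
  define r where "r = (\<lambda>Q. sqrt (1 - S / Q\<^sup>2))"
  define \<phi> where "\<phi> = (\<lambda>Q. Q - k * (Q * (1 - S / Q\<^sup>2) - D * r Q) - E)"
  have S: "0 \<le> S" by (simp add: S_def)
  have k: "0 < k" "k \<le> 1/2" using \<Gamma> by (auto simp: k_def field_simps)
  have sub: "S / Q\<^sup>2 < 1" if "E \<le> Q" for Q
  proof -
    have "E\<^sup>2 \<le> Q\<^sup>2" using E that by (intro power_mono) auto
    moreover have "0 < D\<^sup>2" using D by simp
    ultimately have "S < Q\<^sup>2" using E unfolding S_def by linarith
    moreover have "0 < Q\<^sup>2" using E that by simp
    ultimately show ?thesis by simp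
  qed
  have r: "0 < r Q" "(r Q)\<^sup>2 = 1 - S / Q\<^sup>2" if "E \<le> Q" for Q
    using sub[OF that] by (auto simp: r_def)
  have "\<phi> E < 0"
  proof -
    have "(E * r E)\<^sup>2 = E\<^sup>2 - S" using E by (simp add: power_mult_distrib r field_simps)
    then have "D\<^sup>2 < (E * r E)\<^sup>2" using E by (simp add: S_def)
    then have "D < E * r E" using E r[of E] by (intro power2_less_imp_less[of D]) auto
    then have "0 < r E * (E * r E - D)" using r[of E] by simp
    also have "\<dots> = E * (1 - S / E\<^sup>2) - D * r E"
      unfolding r(2)[OF order_refl, symmetric] by (simp add: algebra_simps power2_eq_square)
    finally show ?thesis using k by (simp add: \<phi>_def)
  qed
  moreover have "0 \<le> \<phi> (2 * E)"
  proof -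
    have "2 * E * (1 - S / (2 * E)\<^sup>2) - D * r (2 * E) \<le> 2 * E * 1 - 0"
      using E S D r(1)[of "2 * E"] by (intro diff_mono mult_left_mono) auto
    then have "k * (2 * E * (1 - S / (2 * E)\<^sup>2) - D * r (2 * E)) \<le> k * (2 * E)"
      using k by (intro mult_left_mono) auto
    also have "\<dots> \<le> 1/2 * (2 * E)" using k E by (intro mult_right_mono) auto
    finally show ?thesis by (simp add: \<phi>_def)
  qed
  moreover have "continuous_on {E..2 * E} \<phi>"
    unfolding \<phi>_def r_def using E by (intro continuous_intros) auto
  ultimately obtain Q where Q: "E \<le> Q" "\<phi> Q = 0"
    using IVT'[of \<phi> E 0 "2 * E"] E by auto
  then have EQ: "E < Q" using \<open>\<phi> E < 0\<close> by (cases "E = Q") auto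
  define v where "v = (1 / Q) *\<^sub>R m"
  have mv: "Q *\<^sub>R v = m" using E EQ by (simp add: v_def)
  have v: "v \<bullet> v = S / Q\<^sup>2" by (simp add: v_def S_def power2_eq_square)
  have adm: "(D * r Q, v, 0, Q - E) \<in> admissible_prims"
    using D r(1)[OF Q(1)] EQ sub[OF Q(1)] by (simp add: admissible_prims_iff v)
  have sq: "sqrt (1 - v \<bullet> v) = r Q" by (simp add: v r_def)
  have "\<Gamma> / (\<Gamma> - 1) * (Q - E) = Q * (1 - v \<bullet> v) - D * r Q"
  proof -
    have "Q - E = (\<Gamma> - 1) / \<Gamma> * (Q * (1 - v \<bullet> v) - D * r Q)" using Q(2) by (simp add: \<phi>_def k_def v)
    then show ?thesis using \<Gamma> by simp
  qed
  moreover have "1 - v \<bullet> v \<noteq> 0" using sub[OF Q(1)] unfolding v by linarith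
  ultimately have "total_enthalpy \<Gamma> (D * r Q) v (Q - E) = Q"
    by (simp add: total_enthalpy_def)
  then have "cons_blocks \<Gamma> (D * r Q, v, 0, Q - E) = (D, m, 0, E)"
    using r(1)[OF Q(1)] mv by (simp add: cons_blocks_def Let_def sq)
  then have "cons_of_prim \<Gamma> (D * r Q, v, 0, Q - E) = state_vec D m 0 E"
    using cons_flux_of_prim_eq(1)[OF \<Gamma>(1) adm] by (simp add: of_blocks_def)
  then show ?thesis unfolding admissible_set_def using adm by (metis image_eqI)
qed

text \<open>
  Up to the positive factor \<open>s = 1 - v \<bullet> v\<close>, the characteristic polynomial of sound waves in the
  \<open>x_i\<close> direction, where \<open>a\<close> is the squared sound speed and \<open>w = v $ i\<close>.
\<close>

definition acoustic_poly :: "real \<Rightarrow> real \<Rightarrow> real \<Rightarrow> real \<Rightarrow> real" where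
  "acoustic_poly a s w x = (1 - a) * (x - w)\<^sup>2 - a * s * (1 - x\<^sup>2)"

text \<open>
  The polynomial is an upward parabola, negative at \<open>w\<close> and nonnegative at \<open>1\<close> and \<open>-1\<close>; hence it has
  roots on both sides of \<open>w\<close> and is nonnegative outside of them.
\<close>

lemma acoustic_poly_roots:
  assumes a: "0 < a" "a < 1" and s: "0 < s" and w: "\<bar>w\<bar> < 1"
  obtains l1 l2 where "l1 < w" "w < l2" "acoustic_poly a s w l1 = 0" "acoustic_poly a s w l2 = 0"
    "\<And>x. x \<le> l1 \<or> l2 \<le> x \<Longrightarrow> 0 \<le> acoustic_poly a s w x"
proof -
  let ?q = "acoustic_poly a s w"
  have "w\<^sup>2 < 1" using w by (simp add: abs_square_less_1)
  then have qw: "?q w < 0" using a s by (simp add: acoustic_poly_def)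
  have q1: "0 \<le> ?q 1" and qm1: "0 \<le> ?q (- 1)" using a by (simp_all add: acoustic_poly_def)
  have c: "continuous_on A ?q" for A
    unfolding acoustic_poly_def by (intro continuous_intros)
  obtain l2 where l2: "w \<le> l2" "?q l2 = 0"
    using IVT'[of ?q w 0 1] qw q1 w c by fastforce
  obtain l1 where l1: "l1 \<le> w" "?q l1 = 0"
    using IVT2'[of ?q w 0 "-1"] qw qm1 w c by fastforce
  have ne: "l1 < w" "w < l2" using l1 l2 qw by (auto simp: less_le)
  let ?A = "(1 - a) + a * s"
  have A: "0 < ?A" using a s by (simp add: add_pos_pos)
  have fact: "?q x = ?A * ((x - l1) * (x - l2))" for x
  proof -
    have "(l2 - l1) * (?A * (l1 + l2) - 2 * (1 - a) * w) = ?q l2 - ?q l1"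
      by (simp add: acoustic_poly_def power2_eq_square algebra_simps)
    (* l1 and l2 are distinct roots, so the factor l2 - l1 cancels: Vieta's formula *)
    then have sum: "?A * (l1 + l2) = 2 * (1 - a) * w" using l1 l2 ne by auto
    have "?q x = ?q x - ?q l1" using l1 by simp
    also have "\<dots> = (x - l1) * (?A * (x + l1) - 2 * (1 - a) * w)"
      by (simp add: acoustic_poly_def power2_eq_square algebra_simps)
    also have "\<dots> = ?A * ((x - l1) * (x - l2))"
      unfolding sum[symmetric] by (simp add: algebra_simps)
    finally show ?thesis .
  qed
  show ?thesis
  proof (rule that[OF ne l1(2) l2(2)])
    fix x assume "x \<le> l1 \<or> l2 \<le> x"
    then have "0 \<le> (x - l1) * (x - l2)" using ne
      by (auto intro: mult_nonpos_nonpos mult_nonneg_nonneg)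
    then show "0 \<le> ?q x" unfolding fact using A by simp
  qed
qed

text \<open>
  This is the condition \<open>D\<^sup>2 + m \<bullet> m < E\<^sup>2\<close> for the state \<open>U + (\<eta> / \<alpha>) F\<close> after multiplication by
  \<open>\<alpha>\<^sup>2\<close>, with \<open>\<eta>\<close> a sign, \<open>vv\<close> the squared speed and \<open>s = 1 - vv\<close>. The difference of both sides reduces to
  \<open>(p / s) (K y\<^sup>2 - p s (1 - \<alpha>\<^sup>2))\<close>, while the assumption \<open>ac\<close>, which says that the acoustic polynomial
  is nonnegative at \<open>- \<eta> \<alpha>\<close>, controls \<open>(H - \<Gamma> p) y\<^sup>2\<close> in place of \<open>\<Gamma> K y\<^sup>2\<close>. It suffices that
  \<open>H - \<Gamma> p < \<Gamma> K\<close>, which uses \<open>\<Gamma> \<le> 2\<close>.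
\<close>

lemma energy_gap:
  fixes \<Gamma> \<rho> p vv w y \<alpha> :: real
  assumes \<Gamma>: "1 < \<Gamma>" "\<Gamma> \<le> 2" and pos: "0 < \<rho>" "0 < p" "vv < 1" "0 < y"
    and y: "y = \<alpha> + \<eta> * w" and \<eta>: "\<eta>\<^sup>2 = 1"
    and H: "H = \<rho> + \<Gamma> / (\<Gamma> - 1) * p" and Q: "Q = H / (1 - vv)" and D: "D = \<rho> / sqrt (1 - vv)"
    and ac: "\<Gamma> * p * (1 - vv) * (1 - \<alpha>\<^sup>2) \<le> (H - \<Gamma> * p) * y\<^sup>2"
  shows "D\<^sup>2 * y\<^sup>2 + (Q\<^sup>2 * vv * y\<^sup>2 + 2 * y * \<eta> * p * Q * w + p\<^sup>2) < (Q * y - p * \<alpha>)\<^sup>2"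
proof -
  (* in terms of g, the sign of the coefficients below can be read off from 0 < g <= 1 *)
  define g where "g = \<Gamma> - 1"
  define G where "G = \<Gamma> / (\<Gamma> - 1)"
  define s where "s = 1 - vv"
  define K where "K = 2 * \<rho> * (G - 1) + G * (G - 2) * p"
  have g: "0 < g" "g \<le> 1" using \<Gamma> by (auto simp: g_def)
  have Gg: "\<Gamma> = 1 + g" "G = (1 + g) / g" by (auto simp: g_def G_def)
  have s: "0 < s" using pos by (simp add: s_def)
  have H': "H = \<rho> + G * p" by (simp add: H G_def)
  have "\<Gamma> * K - (H - \<Gamma> * p) = \<rho> * (2 * (1 + g) / g - 1) + p * ((1 + g) * (1 - g) / g\<^sup>2)"
    unfolding K_def H' Gg using g by (simp add: divide_simps) (simp add: power2_eq_square algebra_simps)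
  moreover have "0 < \<rho> * (2 * (1 + g) / g - 1)" using g pos
    by (intro mult_pos_pos) (simp_all add: field_simps)
  moreover have "0 \<le> p * ((1 + g) * (1 - g) / g\<^sup>2)" using g pos by simp
  ultimately have "H - \<Gamma> * p < \<Gamma> * K" by linarith
  then have "(H - \<Gamma> * p) * y\<^sup>2 < \<Gamma> * K * y\<^sup>2" using pos by simp
  then have "\<Gamma> * (p * s * (1 - \<alpha>\<^sup>2)) < \<Gamma> * (K * y\<^sup>2)" using ac by (simp add: s_def mult.assoc)
  then have 1: "p * s * (1 - \<alpha>\<^sup>2) < K * y\<^sup>2" using \<Gamma> by simp
  have D2: "D\<^sup>2 = \<rho>\<^sup>2 / s" using s by (simp add: D s_def power_divide)
  have Qs: "Q = H / s" by (simp add: Q s_def)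
  have \<eta>2: "\<eta> * \<eta> = 1" using \<eta> by (simp add: power2_eq_square)
  have "(Q * y - p * \<alpha>)\<^sup>2 - (D\<^sup>2 * y\<^sup>2 + (Q\<^sup>2 * vv * y\<^sup>2 + 2 * y * \<eta> * p * Q * w + p\<^sup>2))
      = y\<^sup>2 * (Q\<^sup>2 * s - D\<^sup>2) - 2 * Q * p * y * (\<alpha> + \<eta> * w) + p\<^sup>2 * (\<alpha>\<^sup>2 - 1)"
    by (simp add: s_def power2_eq_square algebra_simps)
  also have "\<dots> = y\<^sup>2 * (Q\<^sup>2 * s - D\<^sup>2 - 2 * Q * p) + p\<^sup>2 * (\<alpha>\<^sup>2 - 1)"
    unfolding y[symmetric] by (simp add: power2_eq_square algebra_simps)
  also have "\<dots> = p / s * (K * y\<^sup>2 - p * s * (1 - \<alpha>\<^sup>2))"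
    unfolding D2 Qs K_def H' using s by (simp add: divide_simps) (simp add: power2_eq_square algebra_simps)
  also have "\<dots> > 0" using 1 s pos by simp
  finally show ?thesis by linarith
qed

section \<open>Eigenvectors in primitive variables\<close>

text \<open>
  In the kernel, every variation is a multiple of the variation \<open>dQ\<close> of \<open>\<rho> h W\<^sup>2\<close>, and the energy equation
  becomes \<open>dQ\<close> times a factor that is nonzero because \<open>\<Gamma> / (\<Gamma> - 1) \<ge> 2 > 1 + v \<bullet> v\<close>.
\<close>

lemma d_cons_blocks_kernel_nonmagnetic:
  assumes \<Gamma>: "1 < \<Gamma>" "\<Gamma> \<le> 2" and V: "(\<rho>, v, 0, p) \<in> admissible_prims"
    and X: "d_cons_blocks \<Gamma> (\<rho>, v, 0, p) X = 0"
  shows "X = 0"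
proof -
  obtain r u b q where Xe: "X = (r, u, b, q)" by (cases X)
  define s where "s = 1 - v \<bullet> v"
  define G where "G = \<Gamma> / (\<Gamma> - 1)"
  define H where "H = \<rho> + G * p"
  define dQ where "dQ = d_total_enthalpy \<Gamma> (\<rho>, v, 0, p) (r, u, b, q)"
  have adm: "0 < \<rho>" "0 < p" "0 < s" using V by (auto simp: admissible_prims_iff s_def)
  have G: "2 \<le> G" using \<Gamma> by (simp add: G_def field_simps)
  have H: "0 < H" using adm G by (simp add: H_def add_pos_pos)
  have Q: "total_enthalpy \<Gamma> \<rho> v p = H / s" by (simp add: total_enthalpy_def H_def G_def s_def)
  have comp: "d_mass_density (\<rho>, v, 0, p) (r, u, b, q) = 0" "b = 0"
      "dQ *\<^sub>R v + (H / s) *\<^sub>R u = 0" "dQ - q = 0"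
    using X by (auto simp: Xe d_cons_blocks_def d_momentum_def d_magnetic_pressure_def zero_prod_def
        Q dQ_def)
  have "v \<bullet> (dQ *\<^sub>R v + (H / s) *\<^sub>R u) = 0" unfolding comp by simp
  then have "H * (v \<bullet> u) = - (s * dQ * (v \<bullet> v))"
    using adm by (simp add: inner_add_right field_simps)
  then have vu: "v \<bullet> u = - (s * dQ * (v \<bullet> v)) / H" using H by (simp add: field_simps)
  have "r * s = - (\<rho> * (v \<bullet> u))"
  proof -
    have "(r * s + \<rho> * (v \<bullet> u)) / (s * sqrt s) = 0"
      using comp(1) adm by (simp add: d_mass_density_def Let_def s_def[symmetric] add_divide_distrib)
    then show ?thesis using adm by simp
  qed
  then have "r * s = (\<rho> * dQ * (v \<bullet> v) / H) * s" by (simp add: vu)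
  then have r: "r = \<rho> * dQ * (v \<bullet> v) / H"
    using adm(3) by (metis less_irrefl mult_right_cancel)
  have "dQ = (r + G * q) / s + H * (2 * (v \<bullet> u)) / s\<^sup>2"
    by (simp add: dQ_def d_total_enthalpy_def Let_def s_def G_def H_def)
  moreover have "H * (2 * (v \<bullet> u)) / s\<^sup>2 = - 2 * dQ * (v \<bullet> v) / s"
    unfolding vu using adm H by (simp add: power2_eq_square)
  ultimately have "dQ = (r + G * q - 2 * dQ * (v \<bullet> v)) / s"
    by (simp add: add_divide_distrib diff_divide_distrib)
  then have "dQ * s = r + G * q - 2 * dQ * (v \<bullet> v)"
    using adm by (simp add: nonzero_eq_divide_eq)
  then have "dQ * (G + \<rho> * (v \<bullet> v) / H - (s + 2 * (v \<bullet> v))) = 0"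
    using comp(4) by (simp add: r algebra_simps)
  moreover have "G + \<rho> * (v \<bullet> v) / H - (s + 2 * (v \<bullet> v)) \<noteq> 0"
  proof -
    have "s + 2 * (v \<bullet> v) < 2" using adm by (simp add: s_def)
    moreover have "0 \<le> \<rho> * (v \<bullet> v) / H" using adm H by simp
    ultimately show ?thesis using G by linarith
  qed
  ultimately have "dQ = 0" by simp
  then show ?thesis using comp r H adm by (simp add: Xe zero_prod_def)
qed

text \<open>
  The sound wave of speed \<open>\<mu>\<close> gives an eigenvector. The conservation laws for \<open>D\<close>, \<open>m\<close> and \<open>E\<close> determine the
  variations of \<open>D\<close>, \<open>v\<close> and \<open>Q\<close> from the pressure variation \<open>q\<close>; scaling by \<open>c\<^sup>2\<close>, with
  \<open>c = v $ i - \<mu>\<close>, removes all denominators \<open>c\<close>. What remains is that the prescribed variation of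
  \<open>Q\<close> agrees with the one computed from \<open>r\<close>, \<open>u\<close> and \<open>q\<close>, and this is the characteristic
  equation.
\<close>

lemma acoustic_speed_le_spectral_radius:
  assumes \<Gamma>: "1 < \<Gamma>" "\<Gamma> \<le> 2" and V: "(\<rho>, v, 0, p) \<in> admissible_prims"
    and H: "H = \<rho> + \<Gamma> / (\<Gamma> - 1) * p"
    and char: "(H - \<Gamma> * p) * (\<mu> - v $ i)\<^sup>2 = \<Gamma> * p * (1 - v \<bullet> v) * (1 - \<mu>\<^sup>2)"
    and ne: "\<mu> \<noteq> v $ i"
  shows "\<bar>\<mu>\<bar> \<le> spectral_radius (flux_jacobian \<Gamma> i (cons_of_prim \<Gamma> (\<rho>, v, 0, p)))"
proof -
  define s where "s = 1 - v \<bullet> v"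
  define G where "G = \<Gamma> / (\<Gamma> - 1)"
  define c where "c = v $ i - \<mu>"
  define Q where "Q = total_enthalpy \<Gamma> \<rho> v p"
  define u where "u = c *\<^sub>R (\<mu> *\<^sub>R v - axis i 1)"
  define r where "r = - \<rho> * (\<mu> * v $ i - 1) - \<rho> * c * (\<mu> * (v \<bullet> v) - v $ i) / s"
  define q where "q = Q * c\<^sup>2"
  define X where "X = (r, u, 0 :: real ^ 3, q)"
  have adm: "0 < \<rho>" "0 < p" "0 < s" using V by (auto simp: admissible_prims_iff s_def)
  have G: "2 \<le> G" using \<Gamma> by (simp add: G_def field_simps)
  have HG: "H = \<rho> + G * p" by (simp add: H G_def)
  have Hpos: "0 < H" using adm G by (simp add: HG add_pos_pos)
  have Q: "Q = H / s" by (simp add: Q_def total_enthalpy_def H s_def)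
  have vu: "v \<bullet> u = c * (\<mu> * (v \<bullet> v) - v $ i)"
    by (simp add: u_def inner_diff_right inner_axis)
  have ui: "u $ i = c * (\<mu> * v $ i - 1)" by (simp add: u_def)
  have dD: "d_mass_density (\<rho>, v, 0, p) X = - \<rho> * (\<mu> * v $ i - 1) / sqrt s"
    unfolding d_mass_density_def X_def prod.case Let_def s_def[symmetric] vu r_def
    using adm by (simp add: field_simps)
  have dQ: "d_total_enthalpy \<Gamma> (\<rho>, v, 0, p) X = - Q * (2 * \<mu> * v $ i - \<mu>\<^sup>2 - 1)"
  proof -
    have w: "v $ i = c + \<mu>" and vv: "v \<bullet> v = 1 - s" by (auto simp: c_def s_def)
    have ch: "(H - \<Gamma> * p) * c\<^sup>2 = \<Gamma> * p * s * (1 - \<mu>\<^sup>2)"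
      using char by (simp add: c_def s_def power2_commute)
    have G1: "(G - 1) * \<Gamma> = G" using \<Gamma> by (simp add: G_def field_simps)
    have "(G - 1) * H * c\<^sup>2 - G * p * c\<^sup>2 = (G - 1) * H * c\<^sup>2 - ((G - 1) * \<Gamma>) * p * c\<^sup>2"
      unfolding G1 ..
    also have "\<dots> = (G - 1) * ((H - \<Gamma> * p) * c\<^sup>2)"
      by (simp add: algebra_simps)
    also have "\<dots> = ((G - 1) * \<Gamma>) * (p * s * (1 - \<mu>\<^sup>2))" unfolding ch by simp
    also have "\<dots> = (H - \<rho>) * s * (1 - \<mu>\<^sup>2)" unfolding G1 HG by simp
    finally have ch': "(G - 1) * H * c\<^sup>2 - (H - \<rho>) * c\<^sup>2 = (H - \<rho>) * s * (1 - \<mu>\<^sup>2)"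
      unfolding HG by simp
    have "d_total_enthalpy \<Gamma> (\<rho>, v, 0, p) X = (r + G * q) / s + H * (2 * (v \<bullet> u)) / s\<^sup>2"
      by (simp add: d_total_enthalpy_def X_def Let_def s_def G_def H)
    also have "\<dots> = (r * s + G * H * c\<^sup>2 + 2 * H * (v \<bullet> u)) / s\<^sup>2"
      using adm by (simp add: q_def Q field_simps power2_eq_square)
    also have "r * s + G * H * c\<^sup>2 + 2 * H * (v \<bullet> u) = - H * (2 * \<mu> * v $ i - \<mu>\<^sup>2 - 1) * s"
    proof -
      have "r * s = - \<rho> * (\<mu> * v $ i - 1) * s - \<rho> * c * (\<mu> * (v \<bullet> v) - v $ i)"
        using adm by (simp add: r_def left_diff_distrib)
      then show ?thesis unfolding vu unfolding w vv using ch'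
        by (simp add: power2_eq_square algebra_simps)
    qed
    also have "\<dots> / s\<^sup>2 = - Q * (2 * \<mu> * v $ i - \<mu>\<^sup>2 - 1)"
      using adm by (simp add: Q power2_eq_square)
    finally show ?thesis .
  qed
  have dm: "d_momentum \<Gamma> (\<rho>, v, 0, p) X =
      (- Q * (2 * \<mu> * v $ i - \<mu>\<^sup>2 - 1)) *\<^sub>R v + Q *\<^sub>R u"
    using dQ by (simp add: d_momentum_def X_def Q_def)
  have eig: "d_flux_blocks \<Gamma> i (\<rho>, v, 0, p) X = \<mu> *\<^sub>R d_cons_blocks \<Gamma> (\<rho>, v, 0, p) X"
  proof -
    let ?D = "d_mass_density (\<rho>, v, 0, p) X" and ?m = "d_momentum \<Gamma> (\<rho>, v, 0, p) X"
      and ?Q = "d_total_enthalpy \<Gamma> (\<rho>, v, 0, p) X"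
    have F: "d_flux_blocks \<Gamma> i (\<rho>, v, 0, p) X = (?D * v $ i + \<rho> / sqrt s * u $ i,
        u $ i *\<^sub>R (Q *\<^sub>R v) + v $ i *\<^sub>R ?m + q *\<^sub>R axis i 1, 0, ?m $ i)"
      by (simp add: d_flux_blocks_def X_def d_magnetic_pressure_def Q_def s_def Let_def)
    have C: "d_cons_blocks \<Gamma> (\<rho>, v, 0, p) X = (?D, ?m, 0, ?Q - q)"
      by (simp add: d_cons_blocks_def X_def d_magnetic_pressure_def)
    have 1: "?D * v $ i + \<rho> / sqrt s * u $ i = \<mu> * ?D"
      unfolding dD ui c_def using adm by (simp add: field_simps)
    have 2: "u $ i *\<^sub>R (Q *\<^sub>R v) + v $ i *\<^sub>R ?m + q *\<^sub>R axis i 1 = \<mu> *\<^sub>R ?m"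
      unfolding dm ui unfolding u_def q_def c_def
      by (simp add: Finite_Cartesian_Product.vec_eq_iff power2_eq_square algebra_simps)
    have 3: "?m $ i = \<mu> * (?Q - q)"
      unfolding dm dQ by (simp add: ui q_def c_def power2_eq_square algebra_simps)
    show ?thesis unfolding F C using 1 2 3 by simp
  qed
  have ker: "\<And>Y. d_cons_blocks \<Gamma> (\<rho>, v, 0, p) Y = 0 \<Longrightarrow> Y = 0"
    by (rule d_cons_blocks_kernel_nonmagnetic[OF \<Gamma> V])
  obtain L where der: "(flux \<Gamma> i has_derivative L) (at (cons_of_prim \<Gamma> (\<rho>, v, 0, p)))"
    and L: "\<And>Y. L (of_blocks (d_cons_blocks \<Gamma> (\<rho>, v, 0, p) Y)) = of_blocks (d_flux_blocks \<Gamma> i (\<rho>, v, 0, p) Y)"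
    using flux_has_derivative[OF \<Gamma> V ker, of i] by blast
  have "q \<noteq> 0" using ne adm Hpos by (simp add: q_def Q c_def)
  then have "X \<noteq> 0" by (simp add: X_def zero_prod_def)
  then have "d_cons_blocks \<Gamma> (\<rho>, v, 0, p) X \<noteq> 0" using ker by blast
  then have "of_blocks (d_cons_blocks \<Gamma> (\<rho>, v, 0, p) X) \<noteq> 0"
    using of_blocks_eq_iff[of _ 0] linear_0[OF linear_of_blocks] by metis
  moreover have "L (of_blocks (d_cons_blocks \<Gamma> (\<rho>, v, 0, p) X)) =
      \<mu> *\<^sub>R of_blocks (d_cons_blocks \<Gamma> (\<rho>, v, 0, p) X)"
    unfolding L eig by (rule linear_scale[OF linear_of_blocks])
  ultimately show ?thesis by (rule abs_real_eigenvalue_le_spectral_radius[OF der])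
qed

text \<open>
  A fluid at rest in a magnetic field along the direction of the flux. The magnetic stress
  \<open>- 9/2\<close> along the field outweighs the gas terms, which is what breaks the splitting, while the zero velocity makes the
  Jacobian sparse. With density \<open>1\<close> and pressure \<open>\<Gamma> - 1\<close> the internal energy is \<open>1\<close>.
\<close>

definition parallel_field_state :: "real \<Rightarrow> 3 \<Rightarrow> prim_state" where
  "parallel_field_state \<Gamma> i = (1, 0, axis i 3, \<Gamma> - 1)"

lemma d_cons_flux_parallel_field_state:
  assumes "1 < \<Gamma>"
  shows "d_cons_blocks \<Gamma> (parallel_field_state \<Gamma> i) (r, u, b, q) =
      (r, (\<Gamma> + 10) *\<^sub>R u - axis i (9 * u $ i), b, r + q / (\<Gamma> - 1) + 3 * b $ i)"
    and "d_flux_blocks \<Gamma> i (parallel_field_state \<Gamma> i) (r, u, b, q) =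
      (u $ i, axis i q - 3 *\<^sub>R b, axis i (3 * u $ i) - 3 *\<^sub>R u, (\<Gamma> + 1) * u $ i)"
proof -
  have ax: "x *\<^sub>R axis i y = (axis i (x * y) :: real ^ 3)" for x y
    by (simp add: Finite_Cartesian_Product.vec_eq_iff axis_def)
  have G: "\<Gamma> / (\<Gamma> - 1) = 1 + 1 / (\<Gamma> - 1)" using assms by (simp add: field_simps)
  have Q: "total_enthalpy \<Gamma> 1 0 (\<Gamma> - 1) = \<Gamma> + 1" using assms by (simp add: total_enthalpy_def)
  have dm: "d_momentum \<Gamma> (1, 0, axis i 3, \<Gamma> - 1) (r, u, b, q) = (\<Gamma> + 10) *\<^sub>R u - axis i (9 * u $ i)"
    by (simp add: d_momentum_def Q inner_axis inner_axis_axis ax)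
  have dp: "d_magnetic_pressure (1, 0, axis i 3, \<Gamma> - 1) (r, u, b, q) = 3 * b $ i"
    by (simp add: d_magnetic_pressure_def inner_axis')
  have dD: "d_mass_density (1, 0, axis i 3, \<Gamma> - 1) (r, u, b, q) = r"
    by (simp add: d_mass_density_def)
  have dQ: "d_total_enthalpy \<Gamma> (1, 0, axis i 3, \<Gamma> - 1) (r, u, b, q) = r + q / (\<Gamma> - 1) + q"
  proof -
    have "d_total_enthalpy \<Gamma> (1, 0, axis i 3, \<Gamma> - 1) (r, u, b, q) = r + \<Gamma> / (\<Gamma> - 1) * q"
      by (simp add: d_total_enthalpy_def)
    then show ?thesis unfolding G by (simp only: distrib_right) simp
  qed
  show "d_cons_blocks \<Gamma> (parallel_field_state \<Gamma> i) (r, u, b, q) =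
      (r, (\<Gamma> + 10) *\<^sub>R u - axis i (9 * u $ i), b, r + q / (\<Gamma> - 1) + 3 * b $ i)"
    unfolding parallel_field_state_def d_cons_blocks_def prod.case dm dp dD dQ
    by (simp add: inner_axis')
  show "d_flux_blocks \<Gamma> i (parallel_field_state \<Gamma> i) (r, u, b, q) =
      (u $ i, axis i q - 3 *\<^sub>R b, axis i (3 * u $ i) - 3 *\<^sub>R u, (\<Gamma> + 1) * u $ i)"
  proof -
    have mom: "(q + 3 * b $ i) *\<^sub>R axis i 1 - b $ i *\<^sub>R axis i 3 - 3 *\<^sub>R b = axis i q - 3 *\<^sub>R b"
      by (simp add: Finite_Cartesian_Product.vec_eq_iff axis_def)
    show ?thesis
      unfolding parallel_field_state_def d_flux_blocks_def prod.case dm Let_def dp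
      using mom by (simp add: inner_axis axis_nth ax algebra_simps)
  qed
qed

section \<open>The splitting property without a magnetic field and its failure with one\<close>

text \<open>
  With \<open>y = \<alpha> + \<eta> v $ i\<close>, the shifted state has density \<open>D y / \<alpha>\<close> and energy \<open>(Q y - p \<alpha>) / \<alpha>\<close>.
  The quadratic condition is \<open>energy_gap\<close>. It leaves the sign of the energy open; but the energy is
  positive for large \<open>\<alpha>\<close>, and on its way to a nonpositive value it would vanish at some
  \<open>b \<ge> \<alpha>\<close>, where the quadratic condition also holds and excludes zero.
\<close>

lemma shifted_state_admissible:
  assumes \<Gamma>: "1 < \<Gamma>" "\<Gamma> \<le> 2" and V: "(\<rho>, v, 0, p) \<in> admissible_prims"
    and H: "H = \<rho> + \<Gamma> / (\<Gamma> - 1) * p" and \<eta>: "\<eta>\<^sup>2 = 1" and \<sigma>: "0 < \<sigma>"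
    and ac: "\<And>\<alpha>. \<sigma> \<le> \<alpha> \<Longrightarrow> 0 < \<alpha> + \<eta> * v $ i \<and>
      \<Gamma> * p * (1 - v \<bullet> v) * (1 - \<alpha>\<^sup>2) \<le> (H - \<Gamma> * p) * (\<alpha> + \<eta> * v $ i)\<^sup>2"
    and \<alpha>: "\<sigma> \<le> \<alpha>"
  shows "cons_of_prim \<Gamma> (\<rho>, v, 0, p) + (\<eta> / \<alpha>) *\<^sub>R flux_of_prim \<Gamma> i (\<rho>, v, 0, p) \<in> admissible_set \<Gamma>"
proof -
  define w where "w = v $ i"
  define s where "s = 1 - v \<bullet> v"
  define Q where "Q = H / (1 - v \<bullet> v)"
  define D where "D = \<rho> / sqrt (1 - v \<bullet> v)"
  have adm: "0 < \<rho>" "0 < p" "v \<bullet> v < 1" using V by (auto simp: admissible_prims_iff)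
  have s: "0 < s" "s \<le> 1" using adm by (auto simp: s_def)
  have G: "2 \<le> \<Gamma> / (\<Gamma> - 1)" using \<Gamma> by (simp add: field_simps)
  have "2 * p \<le> \<Gamma> / (\<Gamma> - 1) * p" using G adm by (intro mult_right_mono) auto
  then have Hp: "p < H" unfolding H using adm by linarith
  have "H \<le> Q"
    using s Hp adm unfolding Q_def s_def[symmetric] by (simp add: field_simps)
  with Hp have Qp: "p < Q" by linarith
  have gap: "D\<^sup>2 * (b + \<eta> * w)\<^sup>2 + (Q\<^sup>2 * (v \<bullet> v) * (b + \<eta> * w)\<^sup>2 + 2 * (b + \<eta> * w) * \<eta> * p * Q * w + p\<^sup>2)
      < (Q * (b + \<eta> * w) - p * b)\<^sup>2" if "\<sigma> \<le> b" for b
    using ac[OF that] by (intro energy_gap[OF \<Gamma> adm _ refl \<eta> H Q_def D_def]) (auto simp: w_def)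
  define y where "y = \<alpha> + \<eta> * w"
  have \<alpha>0: "0 < \<alpha>" and y: "0 < y" using \<sigma> \<alpha> ac[OF \<alpha>] by (auto simp: y_def w_def)
  have Epos: "0 < Q * y - p * \<alpha>"
  proof (rule ccontr)
    assume neg: "\<not> 0 < Q * y - p * \<alpha>"
    (* the value of alpha at which the energy of the shifted state vanishes *)
    define b where "b = - \<eta> * w * Q / (Q - p)"
    have "\<alpha> * (Q - p) \<le> - \<eta> * w * Q" using neg by (simp add: y_def algebra_simps)
    then have "\<alpha> \<le> b" unfolding b_def using Qp by (subst pos_le_divide_eq) auto
    then have b: "\<sigma> \<le> b" using \<alpha> by simp
    have zero: "Q * (b + \<eta> * w) - p * b = 0" using Qp by (simp add: b_def field_simps)
    have wv: "w\<^sup>2 \<le> v \<bullet> v"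
      using power_mono[OF component_le_norm_cart[of v i], of 2] by (simp add: w_def power2_norm_eq_inner)
    define z where "z = b + \<eta> * w"
    have "(Q * z * w + \<eta> * p)\<^sup>2 = Q\<^sup>2 * w\<^sup>2 * z\<^sup>2 + 2 * z * \<eta> * p * Q * w + p\<^sup>2"
      by (simp add: power2_sum power_mult_distrib \<eta>)
    then have "0 \<le> Q\<^sup>2 * w\<^sup>2 * z\<^sup>2 + 2 * z * \<eta> * p * Q * w + p\<^sup>2"
      by (metis zero_le_power2)
    also have "\<dots> \<le> Q\<^sup>2 * (v \<bullet> v) * z\<^sup>2 + 2 * z * \<eta> * p * Q * w + p\<^sup>2"
      using wv by (intro add_right_mono mult_right_mono mult_left_mono) auto
    also have "\<dots> \<le> D\<^sup>2 * z\<^sup>2 + (Q\<^sup>2 * (v \<bullet> v) * z\<^sup>2 + 2 * z * \<eta> * p * Q * w + p\<^sup>2)"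
      by simp
    also have "\<dots> < (Q * z - p * b)\<^sup>2" unfolding z_def by (rule gap[OF b])
    also have "\<dots> = 0" using zero by (simp add: z_def)
    finally show False by simp
  qed
  define m where "m = (Q * y / \<alpha>) *\<^sub>R v + (\<eta> * p / \<alpha>) *\<^sub>R axis i 1"
  have Qt: "total_enthalpy \<Gamma> \<rho> v p = Q" by (simp add: total_enthalpy_def Q_def H)
  have "cons_of_prim \<Gamma> (\<rho>, v, 0, p) + (\<eta> / \<alpha>) *\<^sub>R flux_of_prim \<Gamma> i (\<rho>, v, 0, p) =
      of_blocks (cons_blocks \<Gamma> (\<rho>, v, 0, p) + (\<eta> / \<alpha>) *\<^sub>R flux_blocks \<Gamma> i (\<rho>, v, 0, p))"
    unfolding cons_flux_of_prim_eq[OF \<Gamma>(1) V]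
    by (simp add: linear_add[OF linear_of_blocks] linear_scale[OF linear_of_blocks])
  also have "\<dots> = state_vec (D * y / \<alpha>) m 0 ((Q * y - p * \<alpha>) / \<alpha>)"
  proof -
    have ya: "y / \<alpha> = 1 + \<eta> / \<alpha> * w" using \<alpha>0 by (simp add: y_def add_divide_distrib)
    have "\<rho> / sqrt (1 - v \<bullet> v) + \<eta> / \<alpha> * (\<rho> / sqrt (1 - v \<bullet> v) * w) = D * y / \<alpha>"
      unfolding D_def[symmetric] times_divide_eq_right[symmetric] ya by (simp add: algebra_simps)
    moreover have "Q *\<^sub>R v + (\<eta> / \<alpha>) *\<^sub>R (w *\<^sub>R Q *\<^sub>R v + p *\<^sub>R axis i 1) = m"
      unfolding m_def times_divide_eq_right[symmetric] ya by (simp add: algebra_simps)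
    moreover have "Q - p + \<eta> / \<alpha> * (Q * w) = (Q * y - p * \<alpha>) / \<alpha>"
    proof -
      have "(Q * y - p * \<alpha>) / \<alpha> = Q * (y / \<alpha>) - p" using \<alpha>0 by (simp add: diff_divide_distrib)
      then show ?thesis unfolding ya by (simp add: algebra_simps)
    qed
    ultimately show ?thesis
      by (simp add: of_blocks_def cons_blocks_def flux_blocks_def Let_def Qt w_def[symmetric])
  qed
  also have "\<dots> \<in> admissible_set \<Gamma>"
  proof (rule state_vec_in_admissible_set[OF \<Gamma>])
    show "0 < D * y / \<alpha>" using adm y \<alpha>0 by (simp add: D_def)
    show "0 < (Q * y - p * \<alpha>) / \<alpha>" using Epos \<alpha>0 by simp
    have "m \<bullet> m = (Q\<^sup>2 * (v \<bullet> v) * y\<^sup>2 + 2 * y * \<eta> * p * Q * w + \<eta>\<^sup>2 * p\<^sup>2) / \<alpha>\<^sup>2"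
      using \<alpha>0 by (simp add: m_def inner_add_left inner_add_right inner_axis inner_axis' inner_axis_axis
          w_def field_simps power2_eq_square)
    then have "(D * y / \<alpha>)\<^sup>2 + m \<bullet> m =
        (D\<^sup>2 * y\<^sup>2 + (Q\<^sup>2 * (v \<bullet> v) * y\<^sup>2 + 2 * y * \<eta> * p * Q * w + p\<^sup>2)) / \<alpha>\<^sup>2"
      by (simp add: \<eta> power_divide power_mult_distrib add_divide_distrib)
    also have "\<dots> < (Q * y - p * \<alpha>)\<^sup>2 / \<alpha>\<^sup>2"
      using gap[OF \<alpha>] \<alpha>0 unfolding y_def by (intro divide_strict_right_mono) auto
    finally show "(D * y / \<alpha>)\<^sup>2 + m \<bullet> m < ((Q * y - p * \<alpha>) / \<alpha>)\<^sup>2" by (simp add: power_divide)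
  qed
  finally show ?thesis .
qed

text \<open>
  Both acoustic speeds are eigenvalues of the Jacobian, hence bounded by \<open>\<sigma>\<close> in modulus. So \<open>\<alpha>\<close> and
  \<open>- \<alpha>\<close> lie outside the open interval between them for every \<open>\<alpha> \<ge> \<sigma>\<close>, and the acoustic polynomial is
  nonnegative at both points.
\<close>

lemma LxF_splitting_nonmagnetic:
  assumes \<Gamma>: "1 < \<Gamma>" "\<Gamma> \<le> 2" and V: "(\<rho>, v, 0, p) \<in> admissible_prims"
    and \<sigma>: "spectral_radius (flux_jacobian \<Gamma> i (cons_of_prim \<Gamma> (\<rho>, v, 0, p))) \<le> \<sigma>"
  shows "LxF_splitting_at \<Gamma> i \<sigma> (cons_of_prim \<Gamma> (\<rho>, v, 0, p))"
proof -
  define H where "H = \<rho> + \<Gamma> / (\<Gamma> - 1) * p"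
  define a where "a = \<Gamma> * p / H"
  define s where "s = 1 - v \<bullet> v"
  define w where "w = v $ i"
  have adm: "0 < \<rho>" "0 < p" "v \<bullet> v < 1" using V by (auto simp: admissible_prims_iff)
  have s: "0 < s" using adm by (simp add: s_def)
  have "\<Gamma> \<le> \<Gamma> / (\<Gamma> - 1)" using \<Gamma> by (simp add: field_simps)
  then have "\<Gamma> * p \<le> \<Gamma> / (\<Gamma> - 1) * p" using adm by (intro mult_right_mono) auto
  then have H: "\<Gamma> * p < H" "0 < H" using adm \<Gamma> by (auto simp: H_def add_pos_pos)
  have a: "0 < a" "a < 1" using H adm \<Gamma> by (auto simp: a_def)
  have "norm v < 1" using adm by (simp add: norm_eq_sqrt_inner)
  then have w: "\<bar>w\<bar> < 1" using component_le_norm_cart[of v i] by (simp add: w_def)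
  obtain l1 l2 where l: "l1 < w" "w < l2" "acoustic_poly a s w l1 = 0" "acoustic_poly a s w l2 = 0"
    and outer: "\<And>x. x \<le> l1 \<or> l2 \<le> x \<Longrightarrow> 0 \<le> acoustic_poly a s w x"
    by (rule acoustic_poly_roots[OF a s w]) blast
  have poly: "H * acoustic_poly a s w x = (H - \<Gamma> * p) * (x - w)\<^sup>2 - \<Gamma> * p * s * (1 - x\<^sup>2)" for x
    using H by (simp add: acoustic_poly_def a_def field_simps)
  have bound: "\<bar>x\<bar> \<le> \<sigma>" if "acoustic_poly a s w x = 0" "x \<noteq> w" for x
  proof -
    have "(H - \<Gamma> * p) * (x - v $ i)\<^sup>2 = \<Gamma> * p * (1 - v \<bullet> v) * (1 - x\<^sup>2)"
      using poly[of x] that(1) by (simp add: s_def w_def)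
    from acoustic_speed_le_spectral_radius[OF \<Gamma> V H_def this] that(2) \<sigma> show ?thesis
      by (simp add: w_def)
  qed
  have b1: "- \<sigma> \<le> l1" and b2: "l2 \<le> \<sigma>" using bound[of l1] bound[of l2] l by auto
  have \<sigma>0: "0 < \<sigma>" using b1 b2 l by linarith
  have ac: "0 < \<alpha> + \<eta> * v $ i \<and>
      \<Gamma> * p * (1 - v \<bullet> v) * (1 - \<alpha>\<^sup>2) \<le> (H - \<Gamma> * p) * (\<alpha> + \<eta> * v $ i)\<^sup>2"
    if \<alpha>: "\<sigma> \<le> \<alpha>" and \<eta>: "\<eta> = 1 \<or> \<eta> = - 1" for \<alpha> \<eta>
  proof -
    have "0 \<le> H * acoustic_poly a s w (- \<eta> * \<alpha>)" using \<eta> \<alpha> b1 b2 H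
      by (intro mult_nonneg_nonneg outer) auto
    moreover have "(- \<eta> * \<alpha> - w)\<^sup>2 = (\<alpha> + \<eta> * w)\<^sup>2" "(- \<eta> * \<alpha>)\<^sup>2 = \<alpha>\<^sup>2"
      using \<eta> by (auto simp: power2_eq_square algebra_simps)
    ultimately have "\<Gamma> * p * s * (1 - \<alpha>\<^sup>2) \<le> (H - \<Gamma> * p) * (\<alpha> + \<eta> * w)\<^sup>2"
      unfolding poly by simp
    then show ?thesis using \<eta> \<alpha> b1 b2 l by (auto simp: s_def w_def)
  qed
  have U: "flux \<Gamma> i (cons_of_prim \<Gamma> (\<rho>, v, 0, p)) = flux_of_prim \<Gamma> i (\<rho>, v, 0, p)"
    by (simp add: flux_def prim_of_cons_cons_of_prim[OF \<Gamma> V])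
  show ?thesis
    unfolding LxF_splitting_at_def U
  proof (intro allI impI conjI)
    fix \<alpha> assume \<alpha>: "\<sigma> \<le> \<alpha>"
    show "cons_of_prim \<Gamma> (\<rho>, v, 0, p) + (1 / \<alpha>) *\<^sub>R flux_of_prim \<Gamma> i (\<rho>, v, 0, p) \<in> admissible_set \<Gamma>"
      by (rule shifted_state_admissible[OF \<Gamma> V H_def _ \<sigma>0 _ \<alpha>]) (use ac[of _ 1] in auto)
    have "cons_of_prim \<Gamma> (\<rho>, v, 0, p) + (- 1 / \<alpha>) *\<^sub>R flux_of_prim \<Gamma> i (\<rho>, v, 0, p) \<in> admissible_set \<Gamma>"
      by (rule shifted_state_admissible[OF \<Gamma> V H_def _ \<sigma>0 _ \<alpha>]) (use ac[of _ "- 1"] in auto)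
    then show "cons_of_prim \<Gamma> (\<rho>, v, 0, p) - (1 / \<alpha>) *\<^sub>R flux_of_prim \<Gamma> i (\<rho>, v, 0, p) \<in> admissible_set \<Gamma>"
      by simp
  qed
qed

lemma parallel_field_state_admissible:
  "1 < \<Gamma> \<Longrightarrow> parallel_field_state \<Gamma> i \<in> admissible_prims"
  by (simp add: parallel_field_state_def admissible_prims_iff)

text \<open>
  At the state at rest the derivative of the conservative map can be inverted by hand, which makes the
  Jacobian explicit.
\<close>

lemma parallel_field_flux_has_derivative:
  assumes \<Gamma>: "1 < \<Gamma>" "\<Gamma> \<le> 2"
  shows "\<exists>L. (flux \<Gamma> i has_derivative L) (at (cons_of_prim \<Gamma> (parallel_field_state \<Gamma> i))) \<and>
    (\<forall>D m B E. L (of_blocks (D, m, B, E)) = of_blocks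
      (m $ i / (\<Gamma> + 1), axis i ((\<Gamma> - 1) * (E - D - 3 * B $ i)) - 3 *\<^sub>R B,
       (3 / (\<Gamma> + 10)) *\<^sub>R (axis i (m $ i) - m), m $ i))"
proof -
  let ?V = "parallel_field_state \<Gamma> i"
  note d = d_cons_flux_parallel_field_state[OF \<Gamma>(1), of i]
  have ker: "X = 0" if "d_cons_blocks \<Gamma> ?V X = 0" for X
  proof -
    obtain r u b q where X: "X = (r, u, b, q)" by (cases X)
    have e: "r = 0" "b = 0" "q = 0" "(\<Gamma> + 10) *\<^sub>R u - axis i (9 * u $ i) = 0"
      using that \<Gamma> by (auto simp: X d zero_prod_def)
    have "u $ j = 0" for j
    proof -
      have "((\<Gamma> + 10) *\<^sub>R u - axis i (9 * u $ i)) $ j = 0" unfolding e by simp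
      then show ?thesis using \<Gamma> by (cases "j = i") (auto simp: axis_def)
    qed
    then show ?thesis using e by (simp add: X zero_prod_def Finite_Cartesian_Product.vec_eq_iff)
  qed
  obtain L where der: "(flux \<Gamma> i has_derivative L) (at (cons_of_prim \<Gamma> ?V))"
    and L: "\<And>Y. L (of_blocks (d_cons_blocks \<Gamma> ?V Y)) = of_blocks (d_flux_blocks \<Gamma> i ?V Y)"
    using flux_has_derivative[OF \<Gamma> parallel_field_state_admissible[OF \<Gamma>(1)] ker, of i] by blast
  show ?thesis
  proof (intro exI conjI allI, rule der)
    fix D m B E
    define u :: "real ^ 3" where "u = (\<chi> j. if j = i then m $ i / (\<Gamma> + 1) else m $ j / (\<Gamma> + 10))"
    define q where "q = (\<Gamma> - 1) * (E - D - 3 * B $ i)"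
    have "(\<Gamma> + 1) * u $ i = m $ i" and "\<And>j. j \<noteq> i \<Longrightarrow> (\<Gamma> + 10) * u $ j = m $ j"
      using \<Gamma> by (simp_all add: u_def)
    then have mom: "(\<Gamma> + 10) *\<^sub>R u - axis i (9 * u $ i) = m"
      by (auto simp: Finite_Cartesian_Product.vec_eq_iff axis_def algebra_simps)
    have "d_cons_blocks \<Gamma> ?V (D, u, B, q) = (D, m, B, E)"
      unfolding d mom using \<Gamma> by (simp add: q_def)
    then have "L (of_blocks (D, m, B, E)) = of_blocks (d_flux_blocks \<Gamma> i ?V (D, u, B, q))"
      using L by metis
    also have "d_flux_blocks \<Gamma> i ?V (D, u, B, q) = (m $ i / (\<Gamma> + 1), axis i q - 3 *\<^sub>R B,
       (3 / (\<Gamma> + 10)) *\<^sub>R (axis i (m $ i) - m), m $ i)"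
      using \<Gamma> by (auto simp: d u_def Finite_Cartesian_Product.vec_eq_iff axis_def)
    finally show "L (of_blocks (D, m, B, E)) = of_blocks
      (m $ i / (\<Gamma> + 1), axis i ((\<Gamma> - 1) * (E - D - 3 * B $ i)) - 3 *\<^sub>R B,
       (3 / (\<Gamma> + 10)) *\<^sub>R (axis i (m $ i) - m), m $ i)" by (simp add: q_def)
  qed
qed

lemma cmod_le_1_if_square:
  assumes "\<mu> * \<mu> * z = complex_of_real c * z" "z \<noteq> 0" "\<bar>c\<bar> \<le> 1"
  shows "cmod \<mu> \<le> 1"
proof -
  have "\<mu>\<^sup>2 = complex_of_real c" using assms by (simp add: power2_eq_square)
  then have "(cmod \<mu>)\<^sup>2 \<le> 1" using assms(3) by (metis norm_of_real norm_power)
  then show ?thesis by (simp add: abs_square_le_1)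
qed

text \<open>
  The Jacobian decouples. The components of \<open>m\<close> and \<open>B\<close> orthogonal to the field carry Alfven waves with
  \<open>\<mu>\<^sup>2 = 9 / (\<Gamma> + 10)\<close>; density, energy and parallel momentum carry sound waves with
  \<open>\<mu>\<^sup>2 = (\<Gamma> - 1) (1 - 1 / (\<Gamma> + 1))\<close>; all other eigenvalues vanish.
\<close>

lemma parallel_field_spectral_radius:
  assumes \<Gamma>: "1 < \<Gamma>" "\<Gamma> \<le> 2"
  shows "spectral_radius (flux_jacobian \<Gamma> i (cons_of_prim \<Gamma> (parallel_field_state \<Gamma> i))) \<le> 1"
proof -
  obtain L where der: "(flux \<Gamma> i has_derivative L) (at (cons_of_prim \<Gamma> (parallel_field_state \<Gamma> i)))"
    and L: "\<And>D m B E. L (of_blocks (D, m, B, E)) = of_blocks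
      (m $ i / (\<Gamma> + 1), axis i ((\<Gamma> - 1) * (E - D - 3 * B $ i)) - 3 *\<^sub>R B,
       (3 / (\<Gamma> + 10)) *\<^sub>R (axis i (m $ i) - m), m $ i)"
    using parallel_field_flux_has_derivative[OF \<Gamma>, of i] by blast
  have LU: "L U = of_blocks
      (momentum_field U $ i / (\<Gamma> + 1),
       axis i ((\<Gamma> - 1) * (U $ 8 - U $ 1 - 3 * magnetic_field U $ i)) - 3 *\<^sub>R magnetic_field U,
       (3 / (\<Gamma> + 10)) *\<^sub>R (axis i (momentum_field U $ i) - momentum_field U), momentum_field U $ i)" for U
    using L[of "U $ 1" "momentum_field U" "magnetic_field U" "U $ 8"] of_blocks_blocks[of U]
    by (simp add: blocks_def)
  show ?thesis
  proof (rule spectral_radius_le_by_eigenvalues[OF der])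
    fix \<mu> x y assume nz: "(x, y) \<noteq> (0, 0)"
      and ev: "\<And>r. Complex (L x $ r) (L y $ r) = \<mu> * Complex (x $ r) (y $ r)"
    define d where "d = Complex (x $ 1) (y $ 1)"
    define e where "e = Complex (x $ 8) (y $ 8)"
    define m where "m = (\<lambda>j. Complex (momentum_field x $ j) (momentum_field y $ j))"
    define b where "b = (\<lambda>j. Complex (magnetic_field x $ j) (magnetic_field y $ j))"
    have evm: "Complex (momentum_field (L x) $ j) (momentum_field (L y) $ j) = \<mu> * m j" for j
      using exhaust_3[of j] ev[of 2] ev[of 3] ev[of 4] by (auto simp: momentum_field_def m_def)
    have evb: "Complex (magnetic_field (L x) $ j) (magnetic_field (L y) $ j) = \<mu> * b j" for j
      using exhaust_3[of j] ev[of 5] ev[of 6] ev[of 7] by (auto simp: magnetic_field_def b_def)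
    have ed: "\<mu> * d = complex_of_real (1 / (\<Gamma> + 1)) * m i"
      using ev[of 1] by (simp add: LU of_blocks_def d_def m_def complex_eq_iff)
    have ee: "\<mu> * e = m i"
      using ev[of 8] by (simp add: LU of_blocks_def e_def m_def)
    have emi: "\<mu> * m i = complex_of_real (\<Gamma> - 1) * (e - d - 3 * b i) - 3 * b i"
      using evm[of i] by (simp add: LU of_blocks_def d_def e_def b_def complex_eq_iff)
    have ebi: "\<mu> * b i = 0"
      using evb[of i] by (simp add: LU of_blocks_def complex_eq_iff)
    have emj: "\<mu> * m j = - 3 * b j" if "j \<noteq> i" for j
      using evm[of j] that by (simp add: LU of_blocks_def b_def axis_def complex_eq_iff)
    have ebj: "\<mu> * b j = complex_of_real (- 3 / (\<Gamma> + 10)) * m j" if "j \<noteq> i" for j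
      using evb[of j] that by (simp add: LU of_blocks_def m_def axis_def complex_eq_iff)
    have ne: "d \<noteq> 0 \<or> e \<noteq> 0 \<or> (\<exists>j. m j \<noteq> 0) \<or> (\<exists>j. b j \<noteq> 0)"
    proof (rule ccontr)
      assume "\<not> ?thesis"
      then have "blocks x = 0" "blocks y = 0"
        by (auto simp: blocks_def d_def e_def m_def b_def complex_eq_iff zero_prod_def Finite_Cartesian_Product.vec_eq_iff)
      then have "x = 0" "y = 0"
        using of_blocks_blocks[of x] of_blocks_blocks[of y] linear_0[OF linear_of_blocks] by auto
      with nz show False by simp
    qed
    show "cmod \<mu> \<le> 1"
    proof (cases "\<mu> = 0")
      case False
      then have bi: "b i = 0" using ebi by simp
      show ?thesis
      proof (cases "\<exists>j. j \<noteq> i \<and> m j \<noteq> 0")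
        case True
        then obtain j where j: "j \<noteq> i" "m j \<noteq> 0" by blast
        have "\<mu> * \<mu> * m j = - 3 * (\<mu> * b j)" using emj[OF j(1)] by (simp add: algebra_simps)
        also have "\<dots> = complex_of_real (9 / (\<Gamma> + 10)) * m j" unfolding ebj[OF j(1)] by simp
        finally show ?thesis using j(2) by (rule cmod_le_1_if_square) (use \<Gamma> in auto)
      next
        case mj: False
        then have bj: "b j = 0" for j using ebj[of j] bi False by (cases "j = i") auto
        have mi: "m i \<noteq> 0"
        proof
          assume "m i = 0"
          then have "d = 0" "e = 0" using ed ee False by auto
          with ne mj bj \<open>m i = 0\<close> show False by metis
        qed
        have "\<mu> * \<mu> * m i = \<mu> * (\<mu> * m i)" by (simp add: mult.assoc)
        also have "\<dots> = complex_of_real (\<Gamma> - 1) * (\<mu> * e - \<mu> * d)"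
          unfolding emi bi by (simp add: algebra_simps del: of_real_diff)
        also have "\<dots> = complex_of_real ((\<Gamma> - 1) * (1 - 1 / (\<Gamma> + 1))) * m i"
          unfolding ed ee by (simp add: algebra_simps)
        finally show ?thesis using mi
        proof (rule cmod_le_1_if_square)
          have "(\<Gamma> - 1) * (1 - 1 / (\<Gamma> + 1)) \<le> 1 * 1" using \<Gamma> by (intro mult_mono) auto
          moreover have "0 \<le> (\<Gamma> - 1) * (1 - 1 / (\<Gamma> + 1))" using \<Gamma> by (intro mult_nonneg_nonneg) auto
          ultimately show "\<bar>(\<Gamma> - 1) * (1 - 1 / (\<Gamma> + 1))\<bar> \<le> 1" by simp
        qed
      qed
    qed simp
  qed
qed

text \<open>
  In \<open>U + F\<close> both \<open>m\<close> and \<open>B\<close> are parallel to \<open>axis i 1\<close>, so a primitive state of this vector would have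
  a velocity parallel to the field. For such states the magnetic field decouples:
  \<open>E - 9/2 = Q - p\<close> and \<open>m $ i = Q * v $ i\<close>, and subluminal speed with \<open>\<Gamma> \<le> 2\<close> forces
  \<open>\<bar>m $ i\<bar> < E - 9/2\<close>. Here the right side is \<open>2\<close>, but the left side is at least \<open>7/2\<close>.
\<close>

lemma parallel_field_not_LxF:
  assumes \<Gamma>: "1 < \<Gamma>" "\<Gamma> \<le> 2"
  shows "\<not> LxF_splitting_at \<Gamma> i 1 (cons_of_prim \<Gamma> (parallel_field_state \<Gamma> i))"
proof
  let ?V = "parallel_field_state \<Gamma> i"
  have ax: "x *\<^sub>R axis i y = (axis i (x * y) :: real ^ 3)" for x y
    by (simp add: Finite_Cartesian_Product.vec_eq_iff axis_def)
  note V = parallel_field_state_admissible[OF \<Gamma>(1), of i]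
  have Q: "total_enthalpy \<Gamma> 1 0 (\<Gamma> - 1) = \<Gamma> + 1" using \<Gamma> by (simp add: total_enthalpy_def)
  have C: "cons_blocks \<Gamma> ?V = (1, 0, axis i 3, 13 / 2)"
    by (simp add: parallel_field_state_def cons_blocks_def Q inner_axis_axis)
  have F: "flux_blocks \<Gamma> i ?V = (0, axis i (\<Gamma> - 11 / 2), 0, 0)"
  proof -
    have "(\<Gamma> - 1 + 9 / 2) *\<^sub>R axis i 1 - 3 *\<^sub>R axis i 3 = (axis i (\<Gamma> - 11 / 2) :: real ^ 3)"
      by (simp add: Finite_Cartesian_Product.vec_eq_iff axis_def)
    then show ?thesis
      by (simp add: parallel_field_state_def flux_blocks_def Let_def inner_axis_axis)
  qed
  assume "LxF_splitting_at \<Gamma> i 1 (cons_of_prim \<Gamma> ?V)"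
  then have "cons_of_prim \<Gamma> ?V + flux_of_prim \<Gamma> i ?V \<in> admissible_set \<Gamma>"
    by (auto simp: LxF_splitting_at_def flux_def prim_of_cons_cons_of_prim[OF \<Gamma> V] dest!: spec[of _ 1])
  moreover have "cons_of_prim \<Gamma> ?V + flux_of_prim \<Gamma> i ?V =
      of_blocks (1, axis i (\<Gamma> - 11 / 2), axis i 3, 13 / 2)"
    unfolding cons_flux_of_prim_eq[OF \<Gamma>(1) V] C F
    by (simp add: linear_add[OF linear_of_blocks, symmetric])
  ultimately obtain V' where V': "V' \<in> admissible_prims"
      "cons_of_prim \<Gamma> V' = of_blocks (1, axis i (\<Gamma> - 11 / 2), axis i 3, 13 / 2)"
    by (auto simp: admissible_set_def)
  obtain \<rho> v B p where V'e: "V' = (\<rho>, v, B, p)" by (cases V')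
  have adm: "0 < \<rho>" "0 < p" "v \<bullet> v < 1" using V' by (auto simp: V'e admissible_prims_iff)
  have c: "cons_blocks \<Gamma> (\<rho>, v, B, p) = (1, axis i (\<Gamma> - 11 / 2), axis i 3, 13 / 2)"
    using V' cons_flux_of_prim_eq(1)[OF \<Gamma>(1) V'(1)] by (simp add: V'e of_blocks_eq_iff)
  define Q where "Q = total_enthalpy \<Gamma> \<rho> v p"
  have Qpos: "0 < Q" unfolding Q_def by (rule total_enthalpy_pos[OF \<Gamma>(1) adm])
  note rec = cons_blocks_recover[OF \<Gamma>(1) adm c, folded Q_def]
  have B: "B = axis i 3" using rec(1) by simp
  have Qv: "Q * v $ i = \<Gamma> - 11 / 2"
    using rec(2) by (simp add: B inner_axis inner_axis_axis)
  have vj: "v $ j = 0" if "j \<noteq> i" for j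
  proof -
    have "((Q + B \<bullet> B) *\<^sub>R v) $ j = 0"
      unfolding rec(3) using that by (simp add: B axis_def)
    then show ?thesis using Qpos by (simp add: B inner_axis_axis add_eq_0_iff)
  qed
  have vv: "v \<bullet> v = (v $ i)\<^sup>2"
  proof -
    have "v = axis i (v $ i)" using vj by (simp add: Finite_Cartesian_Product.vec_eq_iff axis_def)
    then show ?thesis by (metis inner_axis_axis inner_real_def power2_eq_square)
  qed
  have E: "Q - p = 2"
    using c unfolding cons_blocks_def prod.case Let_def Q_def[symmetric] B
    by (simp add: vv inner_axis inner_axis_axis power2_eq_square algebra_simps)
  define z where "z = - v $ i"
  have Qz: "7 / 2 \<le> Q * z" using Qv \<Gamma> by (simp add: z_def)
  then have z: "0 < z" using Qpos zero_less_mult_iff[of Q z] by auto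
  have z1: "z < 1" using adm(3) abs_square_less_1[of "v $ i"] unfolding vv z_def by simp
  have "2 * p \<le> \<Gamma> / (\<Gamma> - 1) * p" using \<Gamma> adm by (intro mult_right_mono) (auto simp: field_simps)
  also have "\<dots> < Q * (1 - v \<bullet> v)"
    using adm by (simp add: Q_def total_enthalpy_def)
  also have "\<dots> = Q * (1 - z) * (1 + z)" unfolding vv z_def by (simp add: power2_eq_square algebra_simps)
  also have "\<dots> \<le> Q * (1 - z) * 2" using Qpos z1 by (intro mult_left_mono) auto
  finally have "p < Q - Q * z" by (simp add: algebra_simps)
  then show False using E Qz by linarith
qed

theorem lemma2p8:
  fixes \<Gamma> :: real and i :: 3
  assumes "1 < \<Gamma>" and "\<Gamma> \<le> 2"
  shows "(\<forall>U \<in> admissible_set \<Gamma>. magnetic_field U = 0 \<longrightarrow>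
            (\<forall>\<sigma>. spectral_radius (flux_jacobian \<Gamma> i U) \<le> \<sigma> \<longrightarrow> LxF_splitting_at \<Gamma> i \<sigma> U)) \<and>
         (\<exists>U \<in> admissible_set \<Gamma>. magnetic_field U \<noteq> 0 \<and>
            spectral_radius (flux_jacobian \<Gamma> i U) \<le> 1 \<and> \<not> LxF_splitting_at \<Gamma> i 1 U)"
proof (intro conjI ballI impI allI)
  fix U \<sigma> assume U: "U \<in> admissible_set \<Gamma>" "magnetic_field U = 0"
    "spectral_radius (flux_jacobian \<Gamma> i U) \<le> \<sigma>"
  then obtain \<rho> v B p where V: "(\<rho>, v, B, p) \<in> admissible_prims" "U = cons_of_prim \<Gamma> (\<rho>, v, B, p)"
    by (auto simp: admissible_set_def)
  then have "B = 0" using U(2) by (simp add: cons_of_prim_def)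
  then show "LxF_splitting_at \<Gamma> i \<sigma> U"
    using LxF_splitting_nonmagnetic[OF assms, of \<rho> v p i \<sigma>] V U(3) by simp
next
  let ?U = "cons_of_prim \<Gamma> (parallel_field_state \<Gamma> i)"
  have "?U \<in> admissible_set \<Gamma>"
    unfolding admissible_set_def using parallel_field_state_admissible[OF assms(1)] by blast
  moreover have "magnetic_field ?U \<noteq> 0"
    by (simp add: cons_of_prim_def parallel_field_state_def axis_eq_0_iff)
  ultimately show "\<exists>U \<in> admissible_set \<Gamma>. magnetic_field U \<noteq> 0 \<and>
      spectral_radius (flux_jacobian \<Gamma> i U) \<le> 1 \<and> \<not> LxF_splitting_at \<Gamma> i 1 U"
    using parallel_field_spectral_radius[OF assms] parallel_field_not_LxF[OF assms] by blast
qed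

end
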